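(* Let $\phi:\mathbb{R}\to\mathbb{R}$ be permissible, let $\sigma_w,\sigma_b\ge 0$, let $D\ge 1$ be an integer (the depth), and let $\epsilon,\delta>0$. Then there is an $N_0\in\mathbb{N}$ such that for all $N\ge N_0$ and every input $x_{0,:}\in\{-1,1\}^N$, for the random width-$N$, depth-$D$ network with activation $\phi$ and parameters $\sigma_w,\sigma_b$, with probability at least $1-\delta$ we have, for all $\ell\in\{0,\dots,D\}$ simultaneously, $$|q_\ell-\tilde q_\ell|\le\epsilon .$$
   Context: Permissible: a function $\phi:\mathbb{R}\to\mathbb{R}$ is permissible if (a) the restriction of $\phi$ to any finite interval is bounded; (b) $|\phi(x)|\le\exp(o(x^2))$ as $|x|\to\infty$, i.e. for every $\varepsilon>0$ there is $A$ such that $|\phi(x)|\le\exp(\varepsilon x^2)$ whenever $|x|\ge A$; (c) $\phi$ is measurable. Random network: $\mathrm{Gauss}(0,s^2)$ denotes the normal distribution with mean $0$ and variance $s^2$ (the point mass at $0$ if $s=0$). Fix an input $x_{0,:}\in\{-1,1\}^N$. All entries of $W\in\mathbb{R}^{D\times N\times N}$ and $b\in\mathbb{R}^{D\times N}$ are independent, with $W_{\ell,i,j}\sim\mathrm{Gauss}(0,\sigma_w^2/N)$ and $b_{\ell,i}\sim\mathrm{Gauss}(0,\sigma_b^2)$. For $\ell=1,\dots,D$ and $i=1,\dots,N$, $$h_{\ell,i}=\sum_{j=1}^N W_{\ell,i,j}\,x_{\ell-1,j}+b_{\ell,i},\qquad x_{\ell,i}=\phi(h_{\ell,i}).$$ For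 $\ell\in\{1,\dots,D\}$, $q_\ell=\frac1N\sum_{i=1}^N h_{\ell,i}^2$, and $q_0=1$. Length map: $\tilde q_0=\tilde r_0=1$ and, for $\ell>0$, $$\tilde q_\ell=\sigma_w^2\,\tilde r_{\ell-1}+\sigma_b^2,\qquad \tilde r_\ell=\mathbb{E}_{z\sim\mathrm{Gauss}(0,1)}\big[\phi(\sqrt{\tilde q_\ell}\,z)^2\big].$$ For permissible $\phi$ these are well-defined finite real numbers. *)

theory Defs
  imports "HOL-Probability.Probability"
begin

definition permissible :: "(real \<Rightarrow> real) \<Rightarrow> bool" where
  "permissible \<phi> \<longleftrightarrow>
     (\<forall>a b. bounded (\<phi> ` {a..b})) \<and>
     (\<forall>\<epsilon>>0. \<exists>A. \<forall>x. \<bar>x\<bar> \<ge> A \<longrightarrow> \<bar>\<phi> x\<bar> \<le> exp (\<epsilon> * x\<^sup>2)) \<and>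
     \<phi> \<in> borel_measurable borel"

text \<open>The argument of \<open>gauss\<close> is the variance, whereas \<^const>\<open>normal_density\<close> takes the
  standard deviation and is not a density when that is 0.\<close>

definition gauss :: "real \<Rightarrow> real measure" where
  "gauss v = (if v = 0 then return borel 0 else density lborel (normal_density 0 (sqrt v)))"

lemma prob_space_gauss:
  assumes "v \<ge> 0"
  shows "prob_space (gauss v)"
proof (cases "v = 0")
  case True
  then show ?thesis by (simp add: gauss_def prob_space_return)
next
  case False
  with assms have "sqrt v > 0" by simp
  then have "prob_space (density lborel (normal_density 0 (sqrt v)))"
    by (rule prob_space_normal_density)
  with False show ?thesis by (simp add: gauss_def)
qed

lemma sets_gauss [simp, measurable_cong]: "sets (gauss v) = sets borel"
  by (simp add: gauss_def)

text \<open>The limiting mean squares of the hidden nodes (\<open>qmap\<close>) and activations (\<open>rmap\<close>).\<close>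

fun qmap rmap :: "(real \<Rightarrow> real) \<Rightarrow> real \<Rightarrow> real \<Rightarrow> nat \<Rightarrow> real" where
  "qmap \<phi> \<sigma>w \<sigma>b 0 = 1"
| "qmap \<phi> \<sigma>w \<sigma>b (Suc l) = \<sigma>w\<^sup>2 * rmap \<phi> \<sigma>w \<sigma>b l + \<sigma>b\<^sup>2"
| "rmap \<phi> \<sigma>w \<sigma>b 0 = 1"
| "rmap \<phi> \<sigma>w \<sigma>b (Suc l) = (LINT z|gauss 1. (\<phi> (sqrt (qmap \<phi> \<sigma>w \<sigma>b (Suc l)) * z))\<^sup>2)"

text \<open>The index sets of the weights and the biases are put side by side in a disjoint sum, so that
  the first condition is joint independence of all entries.\<close>

definition gaussian_params ::
  "nat \<Rightarrow> nat \<Rightarrow> real \<Rightarrow> real \<Rightarrow> 'a measure \<Rightarrow>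
   (nat \<Rightarrow> nat \<Rightarrow> nat \<Rightarrow> 'a \<Rightarrow> real) \<Rightarrow> (nat \<Rightarrow> nat \<Rightarrow> 'a \<Rightarrow> real) \<Rightarrow> bool" where
  "gaussian_params D N \<sigma>w \<sigma>b M W b \<longleftrightarrow>
     prob_space M \<and>
     prob_space.indep_vars M (\<lambda>_. borel)
       (case_sum (\<lambda>(l, i, j). W l i j) (\<lambda>(l, i). b l i))
       (({1..D} \<times> {1..N} \<times> {1..N}) <+> ({1..D} \<times> {1..N})) \<and>
     (\<forall>l\<in>{1..D}. \<forall>i\<in>{1..N}. \<forall>j\<in>{1..N}. distr M borel (W l i j) = gauss (\<sigma>w\<^sup>2 / real N)) \<and>
     (\<forall>l\<in>{1..D}. \<forall>i\<in>{1..N}. distr M borel (b l i) = gauss (\<sigma>b\<^sup>2))"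

text \<open>Such parameters exist for all sizes: take the coordinates of a product measure.\<close>

lemma gaussian_params_exist:
  "\<exists>(M :: (nat \<times> nat \<times> nat + nat \<times> nat \<Rightarrow> real) measure) W b. gaussian_params D N \<sigma>w \<sigma>b M W b"
proof -
  define I where "I = ({1..D} \<times> {1..N} \<times> {1..N}) <+> ({1..D} \<times> {1..N})"
  define G where "G = case_sum (\<lambda>_ :: nat \<times> nat \<times> nat. gauss (\<sigma>w\<^sup>2 / real N))
                               (\<lambda>_ :: nat \<times> nat. gauss (\<sigma>b\<^sup>2))"
  define M where "M = Pi\<^sub>M I G"
  define W where "W = (\<lambda>l i j (\<omega> :: nat \<times> nat \<times> nat + nat \<times> nat \<Rightarrow> real). \<omega> (Inl (l, i, j)))"
  define b where "b = (\<lambda>l i (\<omega> :: nat \<times> nat \<times> nat + nat \<times> nat \<Rightarrow> real). \<omega> (Inr (l, i)))"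
  have psG: "prob_space (G p)" for p
    by (cases p) (auto simp: G_def intro!: prob_space_gauss)
  have setsG: "sets (G p) = sets borel" for p
    by (cases p) (auto simp: G_def)
  interpret prob_space M
    unfolding M_def by (intro prob_space_PiM psG)
  have rv: "(\<lambda>\<omega>. \<omega> p) \<in> borel_measurable M" if "p \<in> I" for p
    using measurable_component_singleton[OF that, of G] measurable_cong_sets[OF refl setsG[of p]]
    unfolding M_def by blast
  have dist: "distr M borel (\<lambda>\<omega>. \<omega> p) = G p" if "p \<in> I" for p
  proof -
    have "distr M borel (\<lambda>\<omega>. \<omega> p) = distr M (G p) (\<lambda>\<omega>. \<omega> p)"
      by (intro distr_cong) (simp_all add: setsG)
    also have "\<dots> = G p"
      unfolding M_def by (intro distr_PiM_component psG that)
    finally show ?thesis .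
  qed
  have indep: "indep_vars (\<lambda>_. borel) (\<lambda>p \<omega>. \<omega> p) I"
  proof (cases "I = {}")
    case True
    then show ?thesis by (simp add: indep_vars_def indep_sets_def)
  next
    case False
    have "distr M (\<Pi>\<^sub>M p\<in>I. borel) (\<lambda>\<omega>. \<lambda>p\<in>I. \<omega> p) = distr M M (\<lambda>\<omega>. \<omega>)"
    proof (rule distr_cong)
      show "sets (\<Pi>\<^sub>M p\<in>I. borel) = sets M"
        unfolding M_def by (intro sets_PiM_cong) (simp_all add: setsG)
      show "(\<lambda>p\<in>I. \<omega> p) = \<omega>" if "\<omega> \<in> space M" for \<omega>
        using that by (auto simp: M_def space_PiM PiE_def extensional_restrict)
    qed simp
    also have "\<dots> = (\<Pi>\<^sub>M p\<in>I. distr M borel (\<lambda>\<omega>. \<omega> p))"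
      by (simp add: distr_id2 dist M_def[symmetric] cong: PiM_cong)
    finally show ?thesis
      using False rv by (subst indep_vars_iff_distr_eq_PiM') auto
  qed
  have eq: "case_sum (\<lambda>(l, i, j). W l i j) (\<lambda>(l, i). b l i) = (\<lambda>p \<omega>. \<omega> p)"
    by (auto simp: W_def b_def fun_eq_iff split: sum.split)
  have "gaussian_params D N \<sigma>w \<sigma>b M W b"
    unfolding gaussian_params_def eq I_def[symmetric]
    using indep prob_space_axioms
      dist[of "Inl (l, i, j)" for l i j] dist[of "Inr (l, i)" for l i]
    by (intro conjI ballI) (simp_all add: W_def b_def I_def G_def Plus_def image_iff)
  then show ?thesis by blast
qed

text \<open>Below, \<open>W\<close> and \<open>b\<close> are fixed (sampled) parameters; layers and nodes are indexed from 1, and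
  \<open>x0\<close> is the input vector. \<open>preact N W b l x\<close> is the vector of hidden nodes of layer \<open>l\<close> when
  layer \<open>l - 1\<close> has activations \<open>x\<close>.\<close>

definition preact ::
  "nat \<Rightarrow> (nat \<Rightarrow> nat \<Rightarrow> nat \<Rightarrow> real) \<Rightarrow> (nat \<Rightarrow> nat \<Rightarrow> real) \<Rightarrow> nat \<Rightarrow> (nat \<Rightarrow> real) \<Rightarrow> nat \<Rightarrow> real"
where
  "preact N W b l x i = (\<Sum>j=1..N. W l i j * x j) + b l i"

primrec act ::
  "(real \<Rightarrow> real) \<Rightarrow> nat \<Rightarrow> (nat \<Rightarrow> nat \<Rightarrow> nat \<Rightarrow> real) \<Rightarrow> (nat \<Rightarrow> nat \<Rightarrow> real) \<Rightarrow> (nat \<Rightarrow> real) \<Rightarrow>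
   nat \<Rightarrow> nat \<Rightarrow> real"
where
  "act \<phi> N W b x0 0 = x0"
| "act \<phi> N W b x0 (Suc l) = (\<lambda>i. \<phi> (preact N W b (Suc l) (act \<phi> N W b x0 l) i))"

fun qnet ::
  "(real \<Rightarrow> real) \<Rightarrow> nat \<Rightarrow> (nat \<Rightarrow> nat \<Rightarrow> nat \<Rightarrow> real) \<Rightarrow> (nat \<Rightarrow> nat \<Rightarrow> real) \<Rightarrow> (nat \<Rightarrow> real) \<Rightarrow>
   nat \<Rightarrow> real"
where
  "qnet \<phi> N W b x0 0 = 1"
| "qnet \<phi> N W b x0 (Suc l) =
     (\<Sum>i=1..N. (preact N W b (Suc l) (act \<phi> N W b x0 l) i)\<^sup>2) / real N"

end

theory Submission
  imports Defs
begin

text \<open>Conditionally on the activations \<open>x\<close> of layer \<open>l\<close>, the hidden nodes of layer \<open>l + 1\<close> are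
  independent Gaussians of variance \<open>s = \<sigma>w\<^sup>2 * (\<Sum>j. (x j)\<^sup>2) / N + \<sigma>b\<^sup>2\<close>. Since \<open>\<phi>\<close> is
  permissible, the fourth moments of \<open>\<phi>\<close> under \<open>gauss s\<close> are bounded for bounded \<open>s\<close>, so by
  Chebyshev's inequality the mean square of the activations of layer \<open>l + 1\<close> is close to its
  conditional expectation, a function of \<open>s\<close> alone that is continuous for \<open>s > 0\<close>. By induction on
  the layers, \<open>s\<close> is close to \<open>qmap\<close> with high probability. As \<open>\<phi>\<close> may be discontinuous at 0, the
  induction also carries that \<open>s\<close> vanishes exactly whenever its limit does; this persists because
  a limit 0 forces \<open>\<phi>\<close> to vanish almost everywhere, or at 0 if \<open>s = 0\<close> already (or \<open>\<sigma>w = 0\<close>). Taking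
  the identity in place of \<open>\<phi>\<close> in the last step gives the claim for \<open>qnet\<close>.\<close>

subsection \<open>Gaussian integrals of permissible functions\<close>

text \<open>Beyond some radius the growth condition gives the bound with factor 1; inside it local
  boundedness does, since \<open>exp (c * y\<^sup>2)\<close> is at least 1. The resulting global
  bound supplies the integrable majorants below.\<close>

lemma permissible_exp_bound:
  assumes "permissible \<psi>" and "c > 0"
  obtains K where "K > 0" and "\<And>y. \<bar>\<psi> y\<bar> \<le> K * exp (c * y\<^sup>2)"
proof -
  from assms obtain A where A: "\<And>x. \<bar>x\<bar> \<ge> A \<Longrightarrow> \<bar>\<psi> x\<bar> \<le> exp (c * x\<^sup>2)"
    unfolding permissible_def by meson
  from assms have "bounded (\<psi> ` {- A..A})"
    unfolding permissible_def by blast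
  then obtain B where "\<forall>y\<in>\<psi> ` {- A..A}. norm y \<le> B"
    unfolding bounded_iff by blast
  then have B: "\<And>x. x \<in> {- A..A} \<Longrightarrow> \<bar>\<psi> x\<bar> \<le> B" by simp
  define K where "K = max 1 B"
  have "\<bar>\<psi> y\<bar> \<le> K * exp (c * y\<^sup>2)" for y
  proof (cases "\<bar>y\<bar> \<ge> A")
    case True
    have "1 * exp (c * y\<^sup>2) \<le> K * exp (c * y\<^sup>2)"
      by (intro mult_right_mono) (auto simp: K_def)
    with A[OF True] show ?thesis by linarith
  next
    case False
    then have "y \<in> {- A..A}" by auto
    from B[OF this] have "\<bar>\<psi> y\<bar> \<le> K" by (simp add: K_def)
    also have "K * 1 \<le> K * exp (c * y\<^sup>2)"
      using assms by (intro mult_left_mono) (auto simp: K_def)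
    finally show ?thesis by simp
  qed
  then show ?thesis by (intro that[of K]) (auto simp: K_def)
qed

text \<open>Makes the identity eligible as \<psi> in the layer statements. The growth bound holds as
  |x| is at most e * x^2 once |x| is at least 1 / e.\<close>

lemma permissible_id: "permissible (\<lambda>x. x)"
proof -
  have "\<bar>x\<bar> \<le> exp (e * x\<^sup>2)" if "e > 0" "\<bar>x\<bar> \<ge> 1 / e" for e x :: real
  proof -
    have "\<bar>x\<bar> \<le> e * \<bar>x\<bar> * \<bar>x\<bar>"
      using that mult_right_mono[of 1 "e * \<bar>x\<bar>" "\<bar>x\<bar>"] by (auto simp: field_simps)
    also have "\<dots> = e * x\<^sup>2" by (simp add: power2_eq_square)
    also have "\<dots> \<le> exp (e * x\<^sup>2)" using exp_ge_add_one_self[of "e * x\<^sup>2"] by linarith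
    finally show ?thesis .
  qed
  then show ?thesis
    unfolding permissible_def by (auto intro!: bounded_closed_interval exI)
qed

lemma permissible_measurable [measurable_dest]:
  "permissible \<psi> \<Longrightarrow> \<psi> \<in> borel_measurable borel"
  by (simp add: permissible_def)

lemma space_gauss [simp]: "space (gauss v) = UNIV"
  by (simp add: gauss_def)

text \<open>Scaling a standard normal variable by \<open>sqrt v\<close> covers the point mass as
  well, since the factor is then 0. Integrals for different variances thus become integrals over the
  single measure \<open>gauss 1\<close>.\<close>

lemma gauss_eq_distr:
  assumes "v \<ge> 0"
  shows "gauss v = distr (gauss 1) borel (\<lambda>z. sqrt v * z)"
proof (cases "v = 0")
  case True
  interpret prob_space "gauss 1" by (rule prob_space_gauss) simp
  from True show ?thesis by (simp add: gauss_def[of 0] distr_const)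
next
  case False
  interpret prob_space "gauss 1" by (rule prob_space_gauss) simp
  have "distributed (gauss 1) lborel (\<lambda>z. z) (normal_density 0 1)"
    unfolding distributed_def by (auto simp: gauss_def distr_id2)
  then have "distributed (gauss 1) lborel (\<lambda>z. 0 + sqrt v * z) (normal_density (0 + sqrt v * 0) (\<bar>sqrt v\<bar> * 1))"
    using False assms by (intro normal_density_affine) auto
  then have "distr (gauss 1) lborel (\<lambda>z. sqrt v * z) = density lborel (normal_density 0 (sqrt v))"
    using assms by (simp add: distributed_def)
  also have "distr (gauss 1) lborel (\<lambda>z. sqrt v * z) = distr (gauss 1) borel (\<lambda>z. sqrt v * z)"
    by (rule distr_cong) auto
  finally show ?thesis using False by (simp add: gauss_def)
qed

text \<open>Characteristic functions treat the point mass and the nondegenerate case alike.\<close>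

lemma char_gauss:
  assumes "v \<ge> 0"
  shows "char (gauss v) t = complex_of_real (exp (- (v * t\<^sup>2) / 2))"
proof -
  have "gauss 1 = std_normal_distribution" by (simp add: gauss_def)
  then have "char (distr (gauss 1) borel (\<lambda>z. sqrt v * z)) t = char std_normal_distribution (sqrt v * t)"
    unfolding char_def by (subst integral_distr) (auto simp: mult_ac)
  then show ?thesis
    using assms by (simp add: gauss_eq_distr[of v] char_std_normal_distribution power_mult_distrib)
qed

text \<open>Against the standard density the integrand becomes a multiple of exp(-z^2/4), which is
  the shape of the normal density of variance 2.\<close>

lemma integrable_gauss_exp: "integrable (gauss 1) (\<lambda>z. exp (z\<^sup>2 / 4))"
proof -
  \<comment> \<open>The ratio of the normalising constants for variances 1 and 2.\<close>
  define c where "c = 1 / sqrt (2 * pi) * sqrt (2 * pi * (sqrt 2)\<^sup>2)"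
  have "exp (- z\<^sup>2 / 2) * exp (z\<^sup>2 / 4) = exp (- z\<^sup>2 / 4)" for z :: real
    by (simp only: exp_add[symmetric]) simp
  then have "c * normal_density 0 (sqrt 2) z = normal_density 0 1 z *\<^sub>R exp (z\<^sup>2 / 4)" for z
    by (simp add: c_def normal_density_def)
  then have eq: "(\<lambda>z. c * normal_density 0 (sqrt 2) z) = (\<lambda>z. normal_density 0 1 z *\<^sub>R exp (z\<^sup>2 / 4))"
    by (rule ext)
  have "integrable lborel (\<lambda>z. c * normal_density 0 (sqrt 2) z)"
    by (intro integrable_mult_right integrable_normal_density) simp
  also note eq
  finally show ?thesis
    by (simp add: gauss_def integrable_density)
qed

text \<open>The step from \<open>qmap\<close> to \<open>rmap\<close> as a function of the variance.
  The integrand stays a parameter so that both \<phi> and the identity can be inserted.\<close>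

definition mean_sq :: "(real \<Rightarrow> real) \<Rightarrow> real \<Rightarrow> real" where
  "mean_sq \<psi> v = (LINT y|gauss v. (\<psi> y)\<^sup>2)"

lemma mean_sq_eq:
  assumes "permissible \<psi>" "v \<ge> 0"
  shows "mean_sq \<psi> v = (LINT z|gauss 1. (\<psi> (sqrt v * z))\<^sup>2)"
  using assms unfolding mean_sq_def
  by (subst gauss_eq_distr[OF assms(2)], subst integral_distr) auto

lemma mean_sq_nonneg: "mean_sq \<psi> v \<ge> 0"
  by (simp add: mean_sq_def)

text \<open>One constant serves all variances up to \<open>S\<close>. This uniformity matters
  because the variance at which it is used depends on the random activations of the previous
  layer.\<close>

lemma permissible_fourth_moment:
  assumes \<psi>: "permissible \<psi>" and S: "S > 0"
  shows "\<exists>C. \<forall>s\<in>{0..S}. integrable (gauss s) (\<lambda>y. (\<psi> y) ^ 4) \<and> (LINT y|gauss s. (\<psi> y) ^ 4) \<le> C"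
proof -
  note [measurable] = permissible_measurable[OF \<psi>]
  \<comment> \<open>With this exponent, the fourth power at \<open>sqrt s * z\<close> grows at most
    like exp((s/S) * z^2/4), which \<open>integrable_gauss_exp\<close> controls for s \<le>
    S.\<close>
  obtain K where K: "K > 0" "\<And>y. \<bar>\<psi> y\<bar> \<le> K * exp (1 / (16 * S) * y\<^sup>2)"
    using permissible_exp_bound[OF \<psi>, of "1 / (16 * S)"] S by auto
  define C where "C = (LINT z|gauss 1. K ^ 4 * exp (z\<^sup>2 / 4))"
  have int: "integrable (gauss 1) (\<lambda>z. K ^ 4 * exp (z\<^sup>2 / 4))"
    by (intro integrable_mult_right integrable_gauss_exp)
  have bound: "(\<psi> (sqrt s * z)) ^ 4 \<le> K ^ 4 * exp (z\<^sup>2 / 4)" if "0 \<le> s" "s \<le> S" for s z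
  proof -
    have "(\<psi> (sqrt s * z)) ^ 4 = \<bar>\<psi> (sqrt s * z)\<bar> ^ 4" by simp
    also have "\<dots> \<le> (K * exp (1 / (16 * S) * (sqrt s * z)\<^sup>2)) ^ 4"
      by (intro power_mono K) auto
    also have "\<dots> = K ^ 4 * exp (s / S * (z\<^sup>2 / 4))"
      using that by (simp add: power_mult_distrib exp_of_nat_mult[symmetric] field_simps)
    also have "\<dots> \<le> K ^ 4 * exp (1 * (z\<^sup>2 / 4))"
      using that S by (intro mult_left_mono exp_le_cancel_iff[THEN iffD2] mult_right_mono) auto
    finally show ?thesis by simp
  qed
  have *: "integrable (gauss 1) (\<lambda>z. (\<psi> (sqrt s * z)) ^ 4)" if "0 \<le> s" "s \<le> S" for s
    using bound[OF that] by (intro Bochner_Integration.integrable_bound[OF int]) (auto simp: K)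
  show ?thesis
  proof (intro exI ballI conjI)
    fix s assume "s \<in> {0..S}"
    then have s: "0 \<le> s" "s \<le> S" by auto
    show "integrable (gauss s) (\<lambda>y. (\<psi> y) ^ 4)"
      using *[OF s] by (subst gauss_eq_distr[OF s(1)], subst integrable_distr_eq) auto
    have "(LINT y|gauss s. (\<psi> y) ^ 4) = (LINT z|gauss 1. (\<psi> (sqrt s * z)) ^ 4)"
      by (subst gauss_eq_distr[OF s(1)], subst integral_distr) auto
    also have "\<dots> \<le> C"
      unfolding C_def using bound[OF s] by (intro integral_mono *[OF s] int)
    finally show "(LINT y|gauss s. (\<psi> y) ^ 4) \<le> C" .
  qed
qed

lemma integrable_gauss_permissible_sq:
  assumes \<psi>: "permissible \<psi>" and s: "s \<ge> 0"
  shows "integrable (gauss s) (\<lambda>y. (\<psi> y)\<^sup>2)"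
proof -
  note [measurable] = permissible_measurable[OF \<psi>]
  interpret prob_space "gauss s" using s by (rule prob_space_gauss)
  \<comment> \<open>The upper end is \<open>s + 1\<close> because it must be positive even for s =
    0.\<close>
  have "0 < s + 1" "s \<in> {0..s + 1}" using s by auto
  with permissible_fourth_moment[OF \<psi>, of "s + 1"]
  have "integrable (gauss s) (\<lambda>y. (\<psi> y) ^ 4)" by blast
  then have "integrable (gauss s) (\<lambda>y. ((\<psi> y)\<^sup>2)\<^sup>2)" by simp
  then show ?thesis by (rule square_integrable_imp_integrable[rotated]) measurable
qed

lemma mean_sq_eq_lborel:
  assumes "permissible \<psi>" "v > 0"
  shows "mean_sq \<psi> v = (LINT y|lborel. normal_density 0 (sqrt v) y * (\<psi> y)\<^sup>2)"
  using assms unfolding mean_sq_def gauss_def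
  by (simp add: integral_density)

text \<open>For positive variance the dependence on v can be put into the normal density, which is
  continuous in v, while \<psi> stays fixed; so a discontinuous \<psi> does no harm. Dominated
  convergence does the rest.\<close>

lemma continuous_on_mean_sq:
  assumes \<psi>: "permissible \<psi>" and a: "0 < a"
  shows "continuous_on {a..b} (mean_sq \<psi>)"
  unfolding continuous_on_sequentially
proof (intro allI ballI impI, elim conjE)
  note [measurable] = permissible_measurable[OF \<psi>]
  fix s v assume v: "v \<in> {a..b}" and sa: "\<forall>n. s n \<in> {a..b}" and lim: "s \<longlonglongrightarrow> v"
  then have b: "0 < b" using a by auto
  \<comment> \<open>The square of \<psi> then grows at most like exp(y^2/(4b)), while the densities
    for variances up to b decay at least like exp(-y^2/(2b)). What remains is exp(-y^2/(4b)), the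
    shape of the density of variance 2b.\<close>
  obtain K where K: "K > 0" "\<And>y. \<bar>\<psi> y\<bar> \<le> K * exp (1 / (8 * b) * y\<^sup>2)"
    using permissible_exp_bound[OF \<psi>, of "1 / (8 * b)"] b by auto
  \<comment> \<open>The factor \<open>sqrt (2 * b / a)\<close> replaces the normalisation for
    variance 2b by that for variance a, the largest one on the interval.\<close>
  define g where "g = (\<lambda>y. K\<^sup>2 * sqrt (2 * b / a) * normal_density 0 (sqrt (2 * b)) y)"
  have bound: "normal_density 0 (sqrt t) y * (\<psi> y)\<^sup>2 \<le> g y" if t: "t \<in> {a..b}" for t y
  proof -
    have "(\<psi> y)\<^sup>2 \<le> (K * exp (1 / (8 * b) * y\<^sup>2))\<^sup>2"
      using power_mono[OF K(2), of y 2] by simp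
    also have "\<dots> = K\<^sup>2 * exp (y\<^sup>2 / (4 * b))"
      by (simp add: power_mult_distrib exp_of_nat_mult[symmetric])
    finally have 1: "(\<psi> y)\<^sup>2 \<le> K\<^sup>2 * exp (y\<^sup>2 / (4 * b))" .
    have "normal_density 0 (sqrt t) y = 1 / sqrt (2 * pi * t) * exp (- (y\<^sup>2 / (2 * t)))"
      using t a by (simp add: normal_density_def)
    also have "\<dots> \<le> 1 / sqrt (2 * pi * a) * exp (- (y\<^sup>2 / (2 * b)))"
      using t a by (intro mult_mono divide_left_mono) (auto intro!: divide_left_mono mult_pos_pos)
    finally have "normal_density 0 (sqrt t) y * (\<psi> y)\<^sup>2
        \<le> (1 / sqrt (2 * pi * a) * exp (- (y\<^sup>2 / (2 * b)))) * (K\<^sup>2 * exp (y\<^sup>2 / (4 * b)))"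
      using 1 a by (intro mult_mono) auto
    also have "\<dots> = K\<^sup>2 / sqrt (2 * pi * a) * (exp (- (y\<^sup>2 / (2 * b))) * exp (y\<^sup>2 / (4 * b)))"
      by simp
    also have "exp (- (y\<^sup>2 / (2 * b))) * exp (y\<^sup>2 / (4 * b)) = exp (- (y\<^sup>2 / (2 * b)) + y\<^sup>2 / (4 * b))"
      by (simp only: exp_add)
    also have "- (y\<^sup>2 / (2 * b)) + y\<^sup>2 / (4 * b) = - (y\<^sup>2 / (4 * b))"
      using b by (simp add: field_simps)
    also have "K\<^sup>2 / sqrt (2 * pi * a) * exp (- (y\<^sup>2 / (4 * b))) = g y"
      using a b by (simp add: g_def normal_density_def real_sqrt_mult real_sqrt_divide field_simps)
    finally show ?thesis .
  qed
  have "(\<lambda>n. LINT y|lborel. normal_density 0 (sqrt (s n)) y * (\<psi> y)\<^sup>2)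
      \<longlonglongrightarrow> (LINT y|lborel. normal_density 0 (sqrt v) y * (\<psi> y)\<^sup>2)"
  proof (rule integral_dominated_convergence[where w = g])
    show "integrable lborel g"
      unfolding g_def using b by (intro integrable_mult_right integrable_normal_density) auto
    show "AE y in lborel. (\<lambda>n. normal_density 0 (sqrt (s n)) y * (\<psi> y)\<^sup>2)
        \<longlonglongrightarrow> normal_density 0 (sqrt v) y * (\<psi> y)\<^sup>2"
      using v a unfolding normal_density_def
      by (intro AE_I2 tendsto_intros lim) auto
    show "AE y in lborel. norm (normal_density 0 (sqrt (s n)) y * (\<psi> y)\<^sup>2) \<le> g y" for n
      using bound sa by (auto intro!: AE_I2)
  qed auto
  moreover have "mean_sq \<psi> v = (LINT y|lborel. normal_density 0 (sqrt v) y * (\<psi> y)\<^sup>2)"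
    using v a by (intro mean_sq_eq_lborel \<psi>) auto
  moreover have "mean_sq \<psi> (s n) = (LINT y|lborel. normal_density 0 (sqrt (s n)) y * (\<psi> y)\<^sup>2)" for n
    using spec[OF sa, of n] a by (intro mean_sq_eq_lborel \<psi>) auto
  ultimately show "(mean_sq \<psi> \<circ> s) \<longlonglongrightarrow> mean_sq \<psi> v"
    by (simp add: comp_def)
qed

text \<open>All nondegenerate centred Gaussians have the null sets of Lebesgue measure, so a
  vanishing mean square says that \<psi> is 0 almost everywhere, whatever the variance.\<close>

lemma mean_sq_eq_0_transfer:
  assumes \<psi>: "permissible \<psi>" and "v > 0" "w > 0" and "mean_sq \<psi> v = 0"
  shows "mean_sq \<psi> w = 0"
proof -
  note [measurable] = permissible_measurable[OF \<psi>]
  have "AE y in gauss v. (\<psi> y)\<^sup>2 = 0"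
    using assms integral_nonneg_eq_0_iff_AE[OF integrable_gauss_permissible_sq[OF \<psi>, of v]]
    by (simp add: mean_sq_def)
  moreover have "gauss v = density lborel (normal_density 0 (sqrt v))"
    using \<open>v > 0\<close> by (simp add: gauss_def)
  ultimately have "AE y in density lborel (normal_density 0 (sqrt v)). (\<psi> y)\<^sup>2 = 0"
    by metis
  then have "AE y in lborel. 0 < normal_density 0 (sqrt v) y \<longrightarrow> (\<psi> y)\<^sup>2 = 0"
    by (subst (asm) AE_density) auto
  then have "AE y in lborel. (\<psi> y)\<^sup>2 = 0"
    using \<open>v > 0\<close> by (auto elim!: eventually_mono simp: normal_density_pos)
  then have "(LINT y|lborel. normal_density 0 (sqrt w) y * (\<psi> y)\<^sup>2) = (LINT y|(lborel :: real measure). 0)"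
    by (intro integral_cong_AE) auto
  then show ?thesis using \<open>w > 0\<close> by (simp add: mean_sq_eq_lborel[OF \<psi>])
qed

text \<open>The map \<open>mean_sq \<psi>\<close> need not be continuous at 0, so there \<open>s\<close> has to be exactly 0.\<close>

lemma mean_sq_near:
  assumes \<psi>: "permissible \<psi>" and v: "v \<ge> 0" and \<eta>: "\<eta> > 0"
  obtains \<kappa> where "\<kappa> > 0" and "\<kappa> \<le> 1"
    and "\<And>s. s \<ge> 0 \<Longrightarrow> \<bar>s - v\<bar> \<le> \<kappa> \<Longrightarrow> (v = 0 \<Longrightarrow> s = 0) \<Longrightarrow>
      \<bar>mean_sq \<psi> s - mean_sq \<psi> v\<bar> < \<eta> \<and> (mean_sq \<psi> v = 0 \<longrightarrow> mean_sq \<psi> s = 0)"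
proof (cases "v = 0")
  case True
  \<comment> \<open>Here s = v = 0 by the last premise, so any radius will do.\<close>
  then show ?thesis using \<eta> by (intro that[of 1]) auto
next
  case False
  with v have v0: "v > 0" by simp
  have "continuous_on {v / 2..2 * v} (mean_sq \<psi>)"
    using v0 by (intro continuous_on_mean_sq \<psi>) simp
  then obtain d where d: "d > 0" "\<And>s. s \<in> {v / 2..2 * v} \<Longrightarrow> \<bar>s - v\<bar> < d \<Longrightarrow> \<bar>mean_sq \<psi> s - mean_sq \<psi> v\<bar> < \<eta>"
    using v0 \<eta> unfolding continuous_on_iff by (fastforce simp: dist_real_def)
  show ?thesis
  \<comment> \<open>The bound \<open>v / 2\<close> keeps s positive and inside the interval of
    continuity, and \<open>d / 2\<close> makes the distance strictly less than d. The bound 1 later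
    confines s to \<open>{0..v + 1}\<close>.\<close>
  proof (rule that[of "min 1 (min (v / 2) (d / 2))"])
    fix s assume "\<bar>s - v\<bar> \<le> min 1 (min (v / 2) (d / 2))"
    then have "\<bar>s - v\<bar> \<le> v / 2" "\<bar>s - v\<bar> \<le> d / 2" by simp_all
    then have "s \<in> {v / 2..2 * v}" "\<bar>s - v\<bar> < d" "s > 0"
      using v0 d(1) by (auto simp: abs_if split: if_splits)
    then show "\<bar>mean_sq \<psi> s - mean_sq \<psi> v\<bar> < \<eta> \<and> (mean_sq \<psi> v = 0 \<longrightarrow> mean_sq \<psi> s = 0)"
      using d mean_sq_eq_0_transfer[OF \<psi> v0] by auto
  qed (use v0 d in auto)
qed

subsection \<open>Concentration within a layer\<close>

text \<open>Adding one variable at a time, the cross term has expectation 0 by independence and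
  centring, so the bound grows only linearly in the number of summands.\<close>

lemma (in prob_space) indep_centered_sum_second_moment:
  fixes Y :: "'i \<Rightarrow> 'a \<Rightarrow> real"
  assumes "finite I" and "indep_vars (\<lambda>_. borel) Y I"
    and "\<And>i. i \<in> I \<Longrightarrow> integrable M (\<lambda>\<omega>. (Y i \<omega>)\<^sup>2)"
    and "\<And>i. i \<in> I \<Longrightarrow> expectation (Y i) = 0"
    and "\<And>i. i \<in> I \<Longrightarrow> expectation (\<lambda>\<omega>. (Y i \<omega>)\<^sup>2) \<le> C"
  shows "integrable M (\<lambda>\<omega>. (\<Sum>i\<in>I. Y i \<omega>)\<^sup>2) \<and>
    expectation (\<lambda>\<omega>. (\<Sum>i\<in>I. Y i \<omega>)\<^sup>2) \<le> real (card I) * C"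
  using assms
proof (induction I rule: finite_induct)
  case empty
  then show ?case by simp
next
  case (insert i I)
  define S where "S = (\<lambda>\<omega>. \<Sum>j\<in>I. Y j \<omega>)"
  have rv: "random_variable borel (Y j)" if "j \<in> insert i I" for j
    using insert.prems(1) that unfolding indep_vars_def by blast
  then have [measurable]: "random_variable borel (Y i)" "random_variable borel S"
    unfolding S_def by (auto intro!: borel_measurable_sum)
  have IH: "integrable M (\<lambda>\<omega>. (S \<omega>)\<^sup>2)" "expectation (\<lambda>\<omega>. (S \<omega>)\<^sup>2) \<le> real (card I) * C"
    using insert.IH[OF indep_vars_subset[OF insert.prems(1)]] insert.prems(2-)
    unfolding S_def by auto
  have Yi: "integrable M (\<lambda>\<omega>. (Y i \<omega>)\<^sup>2)" "expectation (Y i) = 0" "expectation (\<lambda>\<omega>. (Y i \<omega>)\<^sup>2) \<le> C"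
    using insert.prems by auto
  have int: "integrable M (Y i)" "integrable M S"
    using Yi(1) IH(1) by (auto intro: square_integrable_imp_integrable)
  have ind: "indep_var borel (Y i) borel S"
    unfolding S_def by (intro indep_vars_sum insert)
  have YS: "integrable M (\<lambda>\<omega>. Y i \<omega> * S \<omega>)" "expectation (\<lambda>\<omega>. Y i \<omega> * S \<omega>) = 0"
    using indep_var_integrable[OF ind int] indep_var_lebesgue_integral[OF ind int] Yi(2) by auto
  have eq: "(\<lambda>\<omega>. (\<Sum>j\<in>insert i I. Y j \<omega>)\<^sup>2) = (\<lambda>\<omega>. (Y i \<omega>)\<^sup>2 + 2 * (Y i \<omega> * S \<omega>) + (S \<omega>)\<^sup>2)"
    using insert.hyps by (auto simp: S_def power2_sum fun_eq_iff)
  have "expectation (\<lambda>\<omega>. (Y i \<omega>)\<^sup>2 + 2 * (Y i \<omega> * S \<omega>) + (S \<omega>)\<^sup>2)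
      = expectation (\<lambda>\<omega>. (Y i \<omega>)\<^sup>2) + expectation (\<lambda>\<omega>. (S \<omega>)\<^sup>2)"
    using Yi(1) IH(1) YS by simp
  then have "expectation (\<lambda>\<omega>. (Y i \<omega>)\<^sup>2 + 2 * (Y i \<omega> * S \<omega>) + (S \<omega>)\<^sup>2) \<le> real (card (insert i I)) * C"
    using Yi IH insert.hyps by (simp add: distrib_right)
  moreover have "integrable M (\<lambda>\<omega>. (Y i \<omega>)\<^sup>2 + 2 * (Y i \<omega> * S \<omega>) + (S \<omega>)\<^sup>2)"
    by (intro Bochner_Integration.integrable_add integrable_mult_right Yi(1) IH(1) YS(1))
  ultimately show ?case
    unfolding eq by blast
qed

text \<open>Chebyshev's inequality for the centred sum, whose second moment grows linearly while the
  squared threshold grows quadratically in the number of summands.\<close>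

lemma (in prob_space) iid_mean_chebyshev:
  fixes Z :: "'i \<Rightarrow> 'a \<Rightarrow> real" and \<eta> :: real
  assumes I: "finite I" "I \<noteq> {}" and ind: "indep_vars (\<lambda>_. borel) Z I"
    and int: "\<And>i. i \<in> I \<Longrightarrow> integrable M (\<lambda>\<omega>. (Z i \<omega>)\<^sup>2)"
    and mean: "\<And>i. i \<in> I \<Longrightarrow> expectation (Z i) = m"
    and C: "\<And>i. i \<in> I \<Longrightarrow> expectation (\<lambda>\<omega>. (Z i \<omega>)\<^sup>2) \<le> C"
    and \<eta>: "\<eta> > 0"
  shows "prob {\<omega> \<in> space M. \<eta> \<le> \<bar>(\<Sum>i\<in>I. Z i \<omega>) / card I - m\<bar>} \<le> C / (card I * \<eta>\<^sup>2)"
proof -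
  define n where "n = real (card I)"
  have n: "n > 0" using I by (simp add: n_def card_gt_0_iff)
  define Y where "Y = (\<lambda>i \<omega>. Z i \<omega> - m)"
  have rv: "random_variable borel (Z i)" if "i \<in> I" for i
    using ind that unfolding indep_vars_def by blast
  have Z: "integrable M (Z i)" if "i \<in> I" for i
    using rv int that by (blast intro: square_integrable_imp_integrable)
  have "indep_vars (\<lambda>_. borel) Y I"
    unfolding Y_def using indep_vars_compose2[OF ind, of "\<lambda>_ x. x - m" "\<lambda>_. borel"] by simp
  moreover have "integrable M (\<lambda>\<omega>. (Y i \<omega>)\<^sup>2)" if "i \<in> I" for i
    using int[OF that] Z[OF that] by (simp add: Y_def power2_diff)
  moreover have "expectation (Y i) = 0" if "i \<in> I" for i
    using Z[OF that] mean[OF that] by (simp add: Y_def prob_space)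
  moreover have "expectation (\<lambda>\<omega>. (Y i \<omega>)\<^sup>2) \<le> C" if "i \<in> I" for i
  proof -
    \<comment> \<open>Centring only decreases the second moment, so the bound C on the raw moments
      carries over.\<close>
    have "expectation (\<lambda>\<omega>. (Y i \<omega>)\<^sup>2) = expectation (\<lambda>\<omega>. (Z i \<omega>)\<^sup>2) - m\<^sup>2"
      using variance_eq[OF Z[OF that] int[OF that]] mean[OF that] by (simp add: Y_def)
    also have "\<dots> \<le> C" using C[OF that] zero_le_power2[of m] by linarith
    finally show ?thesis .
  qed
  ultimately have *: "integrable M (\<lambda>\<omega>. (\<Sum>i\<in>I. Y i \<omega>)\<^sup>2)"
    "expectation (\<lambda>\<omega>. (\<Sum>i\<in>I. Y i \<omega>)\<^sup>2) \<le> n * C"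
    unfolding n_def using indep_centered_sum_second_moment[OF I(1), of Y C] by auto
  have "(\<Sum>i\<in>I. Z i \<omega>) / n - m = (\<Sum>i\<in>I. Y i \<omega>) / n" for \<omega>
    using n by (simp add: Y_def sum_subtractf n_def[symmetric] field_simps)
  then have "{\<omega> \<in> space M. \<eta> \<le> \<bar>(\<Sum>i\<in>I. Z i \<omega>) / n - m\<bar>} = {\<omega> \<in> space M. n * \<eta> \<le> \<bar>\<Sum>i\<in>I. Y i \<omega>\<bar>}"
    using n by (simp add: field_simps)
  also have "prob \<dots> \<le> expectation (\<lambda>\<omega>. (\<Sum>i\<in>I. Y i \<omega>)\<^sup>2) / (n * \<eta>)\<^sup>2"
    using n \<eta> * rv by (intro second_moment_method) (auto simp: Y_def intro!: borel_measurable_sum)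
  also have "\<dots> \<le> n * C / (n * \<eta>)\<^sup>2"
    using * by (intro divide_right_mono) auto
  also have "\<dots> = C / (n * \<eta>\<^sup>2)"
    using n by (simp add: power2_eq_square)
  finally show ?thesis by (simp add: n_def)
qed

section \<open>The law of one layer for fixed input activations\<close>

abbreviation entries ::
  "(nat \<Rightarrow> nat \<Rightarrow> nat \<Rightarrow> 'b) \<Rightarrow> (nat \<Rightarrow> nat \<Rightarrow> 'b) \<Rightarrow> nat \<times> nat \<times> nat + nat \<times> nat \<Rightarrow> 'b" where
  "entries W b \<equiv> case_sum (\<lambda>(l, i, j). W l i j) (\<lambda>(l, i). b l i)"

text \<open>Variable layer and node sets allow single rows, single layers and initial segments of
  layers to be addressed as blocks of one independent family.\<close>

abbreviation entry_ix :: "nat set \<Rightarrow> nat set \<Rightarrow> nat \<Rightarrow> (nat \<times> nat \<times> nat + nat \<times> nat) set" where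
  "entry_ix L I N \<equiv> (L \<times> I \<times> {1..N}) <+> (L \<times> I)"

lemma gaussian_params_measurable:
  assumes "gaussian_params D N \<sigma>w \<sigma>b M W b" "l \<in> {1..D}" "i \<in> {1..N}"
  shows "j \<in> {1..N} \<Longrightarrow> W l i j \<in> borel_measurable M" and "b l i \<in> borel_measurable M"
proof -
  interpret prob_space M using assms(1) by (simp add: gaussian_params_def)
  have rv: "random_variable borel (entries W b p)" if "p \<in> entry_ix {1..D} {1..N} N" for p
    using assms(1) that unfolding gaussian_params_def indep_vars_def by blast
  show "j \<in> {1..N} \<Longrightarrow> W l i j \<in> borel_measurable M"
    using rv[of "Inl (l, i, j)"] assms by (auto simp: Plus_def image_iff)
  show "b l i \<in> borel_measurable M"
    using rv[of "Inr (l, i)"] assms by (auto simp: Plus_def image_iff)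
qed

text \<open>The bias counts as a weight with input 1, so a hidden node is one linear combination of
  independent entries.\<close>

lemma preact_eq_sum_entries:
  "preact N W b l x i =
    (\<Sum>p\<in>entry_ix {l} {i} N. case_sum (\<lambda>(l, i, j). x j) (\<lambda>_. 1) p * entries W b p)"
proof -
  have "{l} \<times> {i} \<times> {1..N} = (\<lambda>j. (l, i, j)) ` {1..N}" by auto
  then have "(\<Sum>p\<in>{l} \<times> {i} \<times> {1..N}. case p of (l, i, j) \<Rightarrow> x j * W l i j) = (\<Sum>j=1..N. x j * W l i j)"
    by (simp add: sum.reindex inj_on_def)
  then show ?thesis
    by (simp add: preact_def sum.Plus case_prod_unfold mult.commute)
qed

text \<open>The variance of a hidden node given the activations \<open>x\<close> of the layer before
  it: the recursion of \<open>qmap\<close> with the empirical mean square in place of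
  \<open>rmap\<close>.\<close>

definition cond_var :: "real \<Rightarrow> real \<Rightarrow> nat \<Rightarrow> (nat \<Rightarrow> real) \<Rightarrow> real" where
  "cond_var \<sigma>w \<sigma>b N x = \<sigma>w\<^sup>2 * ((\<Sum>j=1..N. (x j)\<^sup>2) / real N) + \<sigma>b\<^sup>2"

lemma cond_var_nonneg: "cond_var \<sigma>w \<sigma>b N x \<ge> 0"
  by (simp add: cond_var_def sum_nonneg)

text \<open>By independence the characteristic function of the node is a product of Gaussian ones,
  so the variances add up. This includes entries of variance 0.\<close>

lemma distr_preact:
  assumes params: "gaussian_params D N \<sigma>w \<sigma>b M W b" and l: "l \<in> {1..D}" and i: "i \<in> {1..N}"
  shows "distr M borel (\<lambda>\<omega>. preact N (\<lambda>l i j. W l i j \<omega>) (\<lambda>l i. b l i \<omega>) l x i)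
    = gauss (cond_var \<sigma>w \<sigma>b N x)" (is "distr M borel ?h = gauss ?s")
proof (rule Levy_uniqueness)
  interpret prob_space M using params by (simp add: gaussian_params_def)
  note [measurable] = gaussian_params_measurable[OF params]
  have h: "random_variable borel ?h"
    unfolding preact_def using l i by measurable
  then show "real_distribution (distr M borel ?h)"
    by (rule real_distribution_distr)
  interpret G: prob_space "gauss ?s"
    by (intro prob_space_gauss cond_var_nonneg)
  show "real_distribution (gauss ?s)"
    by unfold_locales auto
  \<comment> \<open>\<open>c\<close> holds the coefficients of the linear combination and
    \<open>v\<close> the variances of the entries.\<close>
  define c where "c = case_sum (\<lambda>(l :: nat, i :: nat, j). x j) (\<lambda>_ :: nat \<times> nat. 1)"
  define v where "v = case_sum (\<lambda>_ :: nat \<times> nat \<times> nat. \<sigma>w\<^sup>2 / real N) (\<lambda>_ :: nat \<times> nat. \<sigma>b\<^sup>2)"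
  let ?I = "entry_ix {l} {i} N"
  have sub: "?I \<subseteq> entry_ix {1..D} {1..N} N" using l i by auto
  have ind0: "indep_vars (\<lambda>_. borel) (entries W b) ?I"
    using params sub unfolding gaussian_params_def by (blast intro: indep_vars_subset)
  then have ind: "indep_vars (\<lambda>_. borel) (\<lambda>p \<omega>. c p * entries W b p \<omega>) ?I"
    by (rule indep_vars_compose2) measurable
  have ch: "char (distr M borel (\<lambda>\<omega>. c p * entries W b p \<omega>)) t
      = complex_of_real (exp (- (v p * (c p)\<^sup>2 * t\<^sup>2) / 2))" if p: "p \<in> ?I" for p t
  proof -
    have [measurable]: "random_variable borel (entries W b p)"
      using ind0 p unfolding indep_vars_def by blast
    have "distr M borel (entries W b p) = gauss (v p)"
      using params p l i unfolding gaussian_params_def v_def by auto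
    then have "char (distr M borel (entries W b p)) (c p * t) = char (gauss (v p)) (c p * t)" by simp
    also have "\<dots> = complex_of_real (exp (- (v p * (c p * t)\<^sup>2) / 2))"
      by (intro char_gauss) (auto simp: v_def split: sum.split)
    also have "char (distr M borel (entries W b p)) (c p * t)
        = char (distr M borel (\<lambda>\<omega>. c p * entries W b p \<omega>)) t"
      unfolding char_def by (subst (1 2) integral_distr) (auto simp: mult_ac)
    finally show ?thesis by (simp add: power_mult_distrib mult_ac)
  qed
  have "(\<Sum>p\<in>?I. v p * (c p)\<^sup>2) = (\<Sum>j=1..N. \<sigma>w\<^sup>2 / real N * (x j)\<^sup>2) + \<sigma>b\<^sup>2"
  proof -
    have "{l} \<times> {i} \<times> {1..N} = (\<lambda>j. (l, i, j)) ` {1..N}" by auto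
    then show ?thesis
      by (simp add: sum.Plus v_def c_def sum.reindex inj_on_def)
  qed
  also have "\<dots> = ?s"
    by (simp add: cond_var_def sum_distrib_left[symmetric] sum_divide_distrib[symmetric])
  finally have var: "(\<Sum>p\<in>?I. v p * (c p)\<^sup>2) = ?s" .
  have eq: "?h = (\<lambda>\<omega>. \<Sum>p\<in>?I. c p * entries W b p \<omega>)"
  proof
    fix \<omega>
    have "entries (\<lambda>l i j. W l i j \<omega>) (\<lambda>l i. b l i \<omega>) p = entries W b p \<omega>" for p
      by (auto split: sum.split prod.split)
    then show "?h \<omega> = (\<Sum>p\<in>?I. c p * entries W b p \<omega>)"
      by (simp only: preact_eq_sum_entries c_def)
  qed
  show "char (distr M borel ?h) = char (gauss ?s)"
  proof
    fix t
    have "char (distr M borel ?h) t = (\<Prod>p\<in>?I. complex_of_real (exp (- (v p * (c p)\<^sup>2 * t\<^sup>2) / 2)))"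
      unfolding eq by (subst char_distr_sum[OF ind]) (intro prod.cong ch refl)
    also have "\<dots> = complex_of_real (exp (\<Sum>p\<in>?I. - (v p * (c p)\<^sup>2 * t\<^sup>2) / 2))"
      by (simp only: of_real_prod[symmetric] exp_sum finite_Plus finite_cartesian_product finite_atLeastAtMost finite.intros)
    also have "(\<Sum>p\<in>?I. - (v p * (c p)\<^sup>2 * t\<^sup>2) / 2) = - (?s * t\<^sup>2) / 2"
      by (simp only: var[symmetric] sum_distrib_right sum_divide_distrib sum_negf[symmetric])
    also have "complex_of_real (exp (- (?s * t\<^sup>2) / 2)) = char (gauss ?s) t"
      by (simp add: char_gauss cond_var_nonneg)
    finally show "char (distr M borel ?h) t = char (gauss ?s) t" .
  qed
qed

text \<open>For fixed \<open>x\<close>, each node reads only its own row of weights and its own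
  bias, and these blocks are disjoint for different nodes.\<close>

lemma indep_vars_preact:
  assumes params: "gaussian_params D N \<sigma>w \<sigma>b M W b" and l: "l \<in> {1..D}"
  shows "prob_space.indep_vars M (\<lambda>_. borel)
    (\<lambda>i \<omega>. preact N (\<lambda>l i j. W l i j \<omega>) (\<lambda>l i. b l i \<omega>) l x i) {1..N}"
proof -
  interpret prob_space M using params by (simp add: gaussian_params_def)
  let ?K = "\<lambda>i. entry_ix {l} {i} N"
  define H where "H = (\<lambda>i z. preact N (\<lambda>l i j. z (Inl (l, i, j))) (\<lambda>l i. z (Inr (l, i))) l x i)"
  have "indep_vars (\<lambda>_. borel) (entries W b) (entry_ix {1..D} {1..N} N)"
    using params unfolding gaussian_params_def by blast
  then have "indep_vars (\<lambda>i. PiM (?K i) (\<lambda>_. borel)) (\<lambda>i \<omega>. restrict (\<lambda>p. entries W b p \<omega>) (?K i)) {1..N}"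
    by (rule indep_vars_restrict) (use l in \<open>auto simp: disjoint_family_on_def\<close>)
  then have "indep_vars (\<lambda>_. borel) (\<lambda>i \<omega>. H i (restrict (\<lambda>p. entries W b p \<omega>) (?K i))) {1..N}"
  proof (rule indep_vars_compose2)
    fix i assume "i \<in> {1..N}"
    show "H i \<in> borel_measurable (PiM (?K i) (\<lambda>_. borel))"
      unfolding H_def preact_def
      by (intro borel_measurable_add borel_measurable_sum borel_measurable_times
          borel_measurable_const measurable_component_singleton) auto
  qed
  moreover have "H i (restrict (\<lambda>p. entries W b p \<omega>) (?K i))
      = preact N (\<lambda>l i j. W l i j \<omega>) (\<lambda>l i. b l i \<omega>) l x i" for i \<omega>
    unfolding H_def preact_def by (intro arg_cong2[of _ _ _ _ "(+)"] sum.cong) auto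
  ultimately show ?thesis by simp
qed

text \<open>The variables averaged are the squares of \<open>\<psi> (h i \<omega>)\<close>, which is
  why Chebyshev's inequality calls for fourth moments of \<psi>. If their common mean is 0, these
  nonnegative variables vanish almost surely, which yields the exact zeros that the induction
  carries.\<close>

lemma layer_concentration:
  assumes params: "gaussian_params D N \<sigma>w \<sigma>b M W b" and l: "l \<in> {1..D}" and N: "N \<ge> 1"
    and \<psi>: "permissible \<psi>" and \<eta>: "\<eta> > 0"
    and int: "integrable (gauss (cond_var \<sigma>w \<sigma>b N x)) (\<lambda>y. (\<psi> y) ^ 4)"
    and C: "(LINT y|gauss (cond_var \<sigma>w \<sigma>b N x). (\<psi> y) ^ 4) \<le> C"
  defines "h \<equiv> \<lambda>i \<omega>. preact N (\<lambda>l i j. W l i j \<omega>) (\<lambda>l i. b l i \<omega>) l x i"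
  defines "v \<equiv> mean_sq \<psi> (cond_var \<sigma>w \<sigma>b N x)"
  shows "measure M {\<omega> \<in> space M. \<eta> \<le> \<bar>(\<Sum>i=1..N. (\<psi> (h i \<omega>))\<^sup>2) / real N - v\<bar>} \<le> C / (real N * \<eta>\<^sup>2)"
    and "v = 0 \<Longrightarrow> AE \<omega> in M. (\<Sum>i=1..N. (\<psi> (h i \<omega>))\<^sup>2) = 0"
proof -
  interpret prob_space M using params by (simp add: gaussian_params_def)
  note [measurable] = permissible_measurable[OF \<psi>]
  let ?G = "gauss (cond_var \<sigma>w \<sigma>b N x)"
  have ind: "indep_vars (\<lambda>_. borel) h {1..N}"
    unfolding h_def by (rule indep_vars_preact[OF params l])
  have rv: "random_variable borel (h i)" if "i \<in> {1..N}" for i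
    using ind that unfolding indep_vars_def by blast
  have distr: "distr M borel (h i) = ?G" if "i \<in> {1..N}" for i
    unfolding h_def by (rule distr_preact[OF params l that])
  have sq: "integrable M (\<lambda>\<omega>. (\<psi> (h i \<omega>))\<^sup>2)" if "i \<in> {1..N}" for i
    using integrable_gauss_permissible_sq[OF \<psi> cond_var_nonneg, of \<sigma>w \<sigma>b N x]
    unfolding distr[OF that, symmetric] by (subst (asm) integrable_distr_eq) (use rv[OF that] in auto)
  have mean: "expectation (\<lambda>\<omega>. (\<psi> (h i \<omega>))\<^sup>2) = v" if "i \<in> {1..N}" for i
    unfolding v_def mean_sq_def distr[OF that, symmetric]
    by (subst integral_distr) (use rv[OF that] in auto)
  have "prob {\<omega> \<in> space M. \<eta> \<le> \<bar>(\<Sum>i\<in>{1..N}. (\<psi> (h i \<omega>))\<^sup>2) / card {1..N} - v\<bar>} \<le> C / (card {1..N} * \<eta>\<^sup>2)"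
  proof (rule iid_mean_chebyshev)
    show "indep_vars (\<lambda>_. borel) (\<lambda>i \<omega>. (\<psi> (h i \<omega>))\<^sup>2) {1..N}"
      by (rule indep_vars_compose2[OF ind]) measurable
    show "integrable M (\<lambda>\<omega>. ((\<psi> (h i \<omega>))\<^sup>2)\<^sup>2)" if "i \<in> {1..N}" for i
      using int unfolding distr[OF that, symmetric]
      by (subst (asm) integrable_distr_eq) (use rv[OF that] in auto)
    show "expectation (\<lambda>\<omega>. ((\<psi> (h i \<omega>))\<^sup>2)\<^sup>2) \<le> C" if "i \<in> {1..N}" for i
      using C unfolding distr[OF that, symmetric]
      by (subst (asm) integral_distr) (use rv[OF that] in auto)
  qed (use mean N \<eta> in auto)
  then show "measure M {\<omega> \<in> space M. \<eta> \<le> \<bar>(\<Sum>i=1..N. (\<psi> (h i \<omega>))\<^sup>2) / real N - v\<bar>} \<le> C / (real N * \<eta>\<^sup>2)"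
    by simp
  show "AE \<omega> in M. (\<Sum>i=1..N. (\<psi> (h i \<omega>))\<^sup>2) = 0" if "v = 0"
  proof -
    have "AE \<omega> in M. (\<psi> (h i \<omega>))\<^sup>2 = 0" if "i \<in> {1..N}" for i
      using integral_nonneg_eq_0_iff_AE[OF sq[OF that]] mean[OF that] \<open>v = 0\<close> by simp
    then have "AE \<omega> in M. \<forall>i\<in>{1..N}. (\<psi> (h i \<omega>))\<^sup>2 = 0"
      by (intro AE_finite_allI) auto
    then show ?thesis by (rule eventually_mono) (simp add: sum_nonneg_eq_0_iff)
  qed
qed

subsection \<open>Induction over the layers\<close>

text \<open>Only entries of layers up to \<open>l\<close> occur in the hypotheses, so that the lemma
  also applies to coordinate functions on the product space over just these layers.\<close>

lemma measurable_act:
  assumes \<phi>: "\<phi> \<in> borel_measurable borel"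
    and W: "\<And>k i j. k \<in> {1..l} \<Longrightarrow> i \<in> {1..N} \<Longrightarrow> j \<in> {1..N} \<Longrightarrow> W k i j \<in> borel_measurable M"
    and b: "\<And>k i. k \<in> {1..l} \<Longrightarrow> i \<in> {1..N} \<Longrightarrow> b k i \<in> borel_measurable M"
    and i: "i \<in> {1..N}"
  shows "(\<lambda>\<omega>. act \<phi> N (\<lambda>l i j. W l i j \<omega>) (\<lambda>l i. b l i \<omega>) x0 l i) \<in> borel_measurable M"
  using W b i
proof (induction l arbitrary: i)
  case 0
  then show ?case by simp
next
  case (Suc l)
  have [measurable]: "(\<lambda>\<omega>. act \<phi> N (\<lambda>l i j. W l i j \<omega>) (\<lambda>l i. b l i \<omega>) x0 l j) \<in> borel_measurable M"
    if "j \<in> {1..N}" for j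
    by (rule Suc.IH) (use Suc.prems that in auto)
  have "(\<lambda>\<omega>. preact N (\<lambda>l i j. W l i j \<omega>) (\<lambda>l i. b l i \<omega>) (Suc l)
      (act \<phi> N (\<lambda>l i j. W l i j \<omega>) (\<lambda>l i. b l i \<omega>) x0 l) i) \<in> borel_measurable M"
    unfolding preact_def using Suc.prems
    by (intro borel_measurable_add borel_measurable_sum borel_measurable_times) auto
  from measurable_compose[OF this \<phi>] show ?case by simp
qed

text \<open>Shows that restricting the parameters to the layers up to \<open>l\<close> does not
  change the activations of layer \<open>l\<close>.\<close>

lemma act_cong:
  assumes "\<And>k i j. k \<in> {1..l} \<Longrightarrow> i \<in> {1..N} \<Longrightarrow> j \<in> {1..N} \<Longrightarrow> W k i j = W' k i j"
    and "\<And>k i. k \<in> {1..l} \<Longrightarrow> i \<in> {1..N} \<Longrightarrow> b k i = b' k i"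
    and "i \<in> {1..N}"
  shows "act \<phi> N W b x0 l i = act \<phi> N W' b' x0 l i"
  using assms
proof (induction l arbitrary: i)
  case 0
  then show ?case by simp
next
  case (Suc l)
  have "act \<phi> N W b x0 l j = act \<phi> N W' b' x0 l j" if "j \<in> {1..N}" for j
    by (rule Suc.IH) (use Suc.prems that in auto)
  moreover have "W (Suc l) i j = W' (Suc l) i j" "b (Suc l) i = b' (Suc l) i" if "j \<in> {1..N}" for j
    using Suc.prems that by auto
  ultimately have "preact N W b (Suc l) (act \<phi> N W b x0 l) i = preact N W' b' (Suc l) (act \<phi> N W' b' x0 l) i"
    unfolding preact_def using Suc.prems by (intro arg_cong2[of _ _ _ _ "(+)"] sum.cong) auto
  then show ?case by simp
qed

text \<open>The activations of layer \<open>l\<close> are a function of the parameters of the layers up to \<open>l\<close>, hence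
  independent of the parameters of layer \<open>l + 1\<close>; so they may be treated as constants there.\<close>

lemma prob_layer_le:
  fixes P :: "(nat \<Rightarrow> real) \<Rightarrow> (nat \<Rightarrow> real) \<Rightarrow> bool" and x0 :: "nat \<Rightarrow> real"
  assumes params: "gaussian_params D N \<sigma>w \<sigma>b M W b" and l: "l < D"
    and \<phi>: "\<phi> \<in> borel_measurable borel"
    and P [measurable]: "Measurable.pred (PiM {1..N} (\<lambda>_. borel) \<Otimes>\<^sub>M PiM {1..N} (\<lambda>_. borel)) (\<lambda>(x, h). P x h)"
    and bound: "\<And>x. measure M {\<omega> \<in> space M.
      P x (restrict (preact N (\<lambda>l i j. W l i j \<omega>) (\<lambda>l i. b l i \<omega>) (Suc l) x) {1..N})} \<le> \<delta>"
  defines "x \<equiv> \<lambda>\<omega>. act \<phi> N (\<lambda>l i j. W l i j \<omega>) (\<lambda>l i. b l i \<omega>) x0 l"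
  defines "A \<equiv> {\<omega> \<in> space M. P (restrict (x \<omega>) {1..N})
      (restrict (preact N (\<lambda>l i j. W l i j \<omega>) (\<lambda>l i. b l i \<omega>) (Suc l) (x \<omega>)) {1..N})}"
  shows "A \<in> sets M" and "measure M A \<le> \<delta>"
proof -
  interpret prob_space M using params by (simp add: gaussian_params_def)
  let ?S = "PiM {1..N} (\<lambda>_. borel :: real measure)"
  let ?A = "entry_ix {1..l} {1..N} N" and ?K = "entry_ix {Suc l} {1..N} N"
  let ?R = "PiM ?A (\<lambda>_. borel :: real measure)" and ?T = "PiM ?K (\<lambda>_. borel :: real measure)"
  \<comment> \<open>\<open>U\<close> collects the parameters of the layers up to \<open>l\<close>
    and \<open>Y\<close> those of the next layer. \<open>F\<close> and \<open>H\<close> recompute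
    activations and hidden nodes from such blocks, and \<open>E\<close> is the event in these
    coordinates.\<close>
  define U where "U = (\<lambda>\<omega>. restrict (\<lambda>p. entries W b p \<omega>) ?A)"
  define Y where "Y = (\<lambda>\<omega>. restrict (\<lambda>p. entries W b p \<omega>) ?K)"
  define F where "F = (\<lambda>u. restrict (act \<phi> N (\<lambda>l i j. u (Inl (l, i, j))) (\<lambda>l i. u (Inr (l, i))) x0 l) {1..N})"
  define H where "H = (\<lambda>x y. restrict (preact N (\<lambda>l i j. y (Inl (l, i, j))) (\<lambda>l i. y (Inr (l, i))) (Suc l) x) {1..N})"
  define E where "E = {z \<in> space (?R \<Otimes>\<^sub>M ?T). P (F (fst z)) (H (F (fst z)) (snd z))}"
  have "indep_vars (\<lambda>_. borel) (entries W b) (entry_ix {1..D} {1..N} N)"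
    using params unfolding gaussian_params_def by blast
  then have ind: "indep_var ?R U ?T Y"
    unfolding U_def Y_def by (rule indep_var_restrict) (use l in auto)
  have F [measurable]: "F \<in> measurable ?R ?S"
    unfolding F_def
    by (intro measurable_restrict measurable_act \<phi> measurable_component_singleton) auto
  have FU: "F (U \<omega>) = restrict (x \<omega>) {1..N}" for \<omega>
    unfolding F_def x_def U_def by (intro restrict_ext act_cong) auto
  have HY: "H z (Y \<omega>) = restrict (preact N (\<lambda>l i j. W l i j \<omega>) (\<lambda>l i. b l i \<omega>) (Suc l) z) {1..N}" for z \<omega>
    unfolding H_def Y_def preact_def
    by (intro restrict_ext arg_cong2[of _ _ _ _ "(+)"] sum.cong) auto
  \<comment> \<open>Hidden nodes read only the inputs 1 to \<open>N\<close>, so restricting the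
    activation vector is harmless.\<close>
  have H_cong: "H (restrict z {1..N}) y = H z y" for z y
    unfolding H_def preact_def
    by (intro restrict_ext arg_cong2[of _ _ _ _ "(+)"] sum.cong) auto
  have HFU: "H (F (U \<omega>)) (Y \<omega>)
      = restrict (preact N (\<lambda>l i j. W l i j \<omega>) (\<lambda>l i. b l i \<omega>) (Suc l) (x \<omega>)) {1..N}" for \<omega>
    unfolding FU H_cong by (rule HY)
  have U: "U \<in> measurable M ?R" and Y: "Y \<in> measurable M ?T"
    using ind by (blast dest: indep_var_rv1 indep_var_rv2)+
  have "(\<lambda>(x, y). H x y) \<in> measurable (?S \<Otimes>\<^sub>M ?T) ?S"
    unfolding H_def preact_def case_prod_unfold
    by (intro measurable_restrict borel_measurable_add borel_measurable_sum borel_measurable_times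
        measurable_compose[OF measurable_fst measurable_component_singleton]
        measurable_compose[OF measurable_snd measurable_component_singleton]) auto
  moreover have "(\<lambda>z. (F (fst z), snd z)) \<in> measurable (?R \<Otimes>\<^sub>M ?T) (?S \<Otimes>\<^sub>M ?T)"
    by measurable
  ultimately have "(\<lambda>z. H (F (fst z)) (snd z)) \<in> measurable (?R \<Otimes>\<^sub>M ?T) ?S"
    by (auto dest: measurable_compose[rotated])
  then have "(\<lambda>z. (F (fst z), H (F (fst z)) (snd z))) \<in> measurable (?R \<Otimes>\<^sub>M ?T) (?S \<Otimes>\<^sub>M ?S)"
    by (intro measurable_Pair measurable_compose[OF measurable_fst F])
  from measurable_compose[OF this P] have E: "E \<in> sets (?R \<Otimes>\<^sub>M ?T)"
    unfolding E_def by (simp add: pred_def)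
  have XY: "(\<lambda>\<omega>. (U \<omega>, Y \<omega>)) \<in> measurable M (?R \<Otimes>\<^sub>M ?T)"
    by (intro measurable_Pair U Y)
  have "A = (\<lambda>\<omega>. (U \<omega>, Y \<omega>)) -` E \<inter> space M"
    using measurable_space[OF XY]
    unfolding A_def E_def HFU[symmetric] FU[symmetric] by auto
  then have "A \<in> sets M" and A: "emeasure M A = emeasure (distr M (?R \<Otimes>\<^sub>M ?T) (\<lambda>\<omega>. (U \<omega>, Y \<omega>))) E"
    using E XY by (simp_all add: emeasure_distr measurable_sets)
  then show "A \<in> sets M" by simp
  interpret DU: prob_space "distr M ?R U" by (rule prob_space_distr[OF U])
  interpret DY: prob_space "distr M ?T Y" by (rule prob_space_distr[OF Y])
  have "\<delta> \<ge> 0" using bound measure_nonneg order_trans by blast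
  \<comment> \<open>Independence makes the joint law of \<open>U\<close> and \<open>Y\<close> a
    product measure. By Fubini it suffices to bound every section, and there the activations are
    frozen at \<open>F u\<close>, so the hypothesis applies.\<close>
  have "emeasure M A = emeasure (distr M ?R U \<Otimes>\<^sub>M distr M ?T Y) E"
    using ind unfolding A indep_var_distribution_eq by simp
  also have "\<dots> = (\<integral>\<^sup>+u. emeasure (distr M ?T Y) (Pair u -` E) \<partial>distr M ?R U)"
    using E by (intro DY.emeasure_pair_measure_alt) (simp cong: sets_pair_measure_cong)
  also have "\<dots> \<le> (\<integral>\<^sup>+u. ennreal \<delta> \<partial>distr M ?R U)"
  proof (rule nn_integral_mono)
    fix u assume "u \<in> space (distr M ?R U)"
    then have u: "u \<in> space ?R" by simp
    have "emeasure (distr M ?T Y) (Pair u -` E) = emeasure M (Y -` (Pair u -` E) \<inter> space M)"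
      by (intro emeasure_distr Y sets_Pair1[OF E])
    also have "Y -` (Pair u -` E) \<inter> space M = {\<omega> \<in> space M. P (F u) (H (F u) (Y \<omega>))}"
      using u measurable_space[OF Y] by (auto simp: E_def space_pair_measure)
    also have "emeasure M \<dots> \<le> ennreal \<delta>"
      using bound[of "F u"] unfolding HY emeasure_eq_measure by (rule ennreal_leI)
    finally show "emeasure (distr M ?T Y) (Pair u -` E) \<le> ennreal \<delta>" .
  qed
  also have "\<dots> = ennreal \<delta>"
    using DU.emeasure_space_1 by simp
  finally show "measure M A \<le> \<delta>"
    using \<open>\<delta> \<ge> 0\<close> by (simp add: emeasure_eq_measure)
qed

text \<open>The exceptional set is only required to be contained in a small event, so that no measurability
  is needed to combine such statements.\<close>

definition whp ::
  "'a itself \<Rightarrow> nat \<Rightarrow> real \<Rightarrow> real \<Rightarrow>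
   (nat \<Rightarrow> (nat \<Rightarrow> real) \<Rightarrow> (nat \<Rightarrow> nat \<Rightarrow> nat \<Rightarrow> real) \<Rightarrow> (nat \<Rightarrow> nat \<Rightarrow> real) \<Rightarrow> bool) \<Rightarrow> bool" where
  "whp (_ :: 'a itself) D \<sigma>w \<sigma>b Q \<longleftrightarrow>
     (\<forall>\<delta>>0. \<exists>N0. \<forall>N\<ge>N0. \<forall>x0. (\<forall>j\<in>{1..N}. x0 j \<in> {-1, 1}) \<longrightarrow>
        (\<forall>(M :: 'a measure) W b. gaussian_params D N \<sigma>w \<sigma>b M W b \<longrightarrow>
           (\<exists>A\<in>sets M. measure M A \<le> \<delta> \<and>
              (\<forall>\<omega>\<in>space M - A. Q N x0 (\<lambda>l i j. W l i j \<omega>) (\<lambda>l i. b l i \<omega>)))))"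

section \<open>Combining statements that hold with high probability\<close>

lemma whpI:
  assumes "\<And>N x0 W b. N \<ge> 1 \<Longrightarrow> (\<And>j. j \<in> {1..N} \<Longrightarrow> x0 j \<in> {-1, 1}) \<Longrightarrow> Q N x0 W b"
  shows "whp TYPE('a) D \<sigma>w \<sigma>b Q"
  unfolding whp_def
proof (intro allI impI exI)
  fix \<delta> :: real and N :: nat and x0 :: "nat \<Rightarrow> real" and M :: "'a measure" and W b
  \<comment> \<open>The second assumption fixes the threshold, still schematic here, to be
    1.\<close>
  assume "\<delta> > 0" "N \<ge> 1" "\<forall>j\<in>{1..N}. x0 j \<in> {-1, 1}"
  then show "\<exists>A\<in>sets M. measure M A \<le> \<delta> \<and>
      (\<forall>\<omega>\<in>space M - A. Q N x0 (\<lambda>l i j. W l i j \<omega>) (\<lambda>l i. b l i \<omega>))"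
    using assms by (intro bexI[of _ "{}"]) auto
qed

lemma whpD:
  assumes "whp TYPE('a) D \<sigma>w \<sigma>b Q" "\<delta> > 0"
  obtains N0 where "\<And>N x0 (M :: 'a measure) W b.
    N \<ge> N0 \<Longrightarrow> (\<forall>j\<in>{1..N}. x0 j \<in> {-1, 1}) \<Longrightarrow> gaussian_params D N \<sigma>w \<sigma>b M W b \<Longrightarrow>
    \<exists>A\<in>sets M. measure M A \<le> \<delta> \<and> (\<forall>\<omega>\<in>space M - A. Q N x0 (\<lambda>l i j. W l i j \<omega>) (\<lambda>l i. b l i \<omega>))"
proof -
  have "\<exists>N0. \<forall>N\<ge>N0. \<forall>x0. (\<forall>j\<in>{1..N}. x0 j \<in> {-1, 1}) \<longrightarrow>
      (\<forall>(M :: 'a measure) W b. gaussian_params D N \<sigma>w \<sigma>b M W b \<longrightarrow>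
         (\<exists>A\<in>sets M. measure M A \<le> \<delta> \<and>
            (\<forall>\<omega>\<in>space M - A. Q N x0 (\<lambda>l i j. W l i j \<omega>) (\<lambda>l i. b l i \<omega>))))"
    using assms unfolding whp_def by (elim allE impE)
  then obtain N0 where N0: "\<forall>N\<ge>N0. \<forall>x0. (\<forall>j\<in>{1..N}. x0 j \<in> {-1, 1}) \<longrightarrow>
      (\<forall>(M :: 'a measure) W b. gaussian_params D N \<sigma>w \<sigma>b M W b \<longrightarrow>
         (\<exists>A\<in>sets M. measure M A \<le> \<delta> \<and>
            (\<forall>\<omega>\<in>space M - A. Q N x0 (\<lambda>l i j. W l i j \<omega>) (\<lambda>l i. b l i \<omega>))))"
    by (elim exE)
  show ?thesis
    by (rule that) (rule N0[rule_format], simp_all)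
qed

lemma whp_mono:
  assumes "whp TYPE('a) D \<sigma>w \<sigma>b Q" and "\<And>N x0 W b. Q N x0 W b \<Longrightarrow> Q' N x0 W b"
  shows "whp TYPE('a) D \<sigma>w \<sigma>b Q'"
  unfolding whp_def
proof (intro allI impI)
  fix \<delta> :: real assume "\<delta> > 0"
  obtain N0 where N0: "\<And>N x0 (M :: 'a measure) W b.
    N \<ge> N0 \<Longrightarrow> (\<forall>j\<in>{1..N}. x0 j \<in> {-1, 1}) \<Longrightarrow> gaussian_params D N \<sigma>w \<sigma>b M W b \<Longrightarrow>
    \<exists>A\<in>sets M. measure M A \<le> \<delta> \<and> (\<forall>\<omega>\<in>space M - A. Q N x0 (\<lambda>l i j. W l i j \<omega>) (\<lambda>l i. b l i \<omega>))"
    by (rule whpD[OF assms(1) \<open>\<delta> > 0\<close>]) blast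
  show "\<exists>N0. \<forall>N\<ge>N0. \<forall>x0. (\<forall>j\<in>{1..N}. x0 j \<in> {-1, 1}) \<longrightarrow>
      (\<forall>(M :: 'a measure) W b. gaussian_params D N \<sigma>w \<sigma>b M W b \<longrightarrow>
         (\<exists>A\<in>sets M. measure M A \<le> \<delta> \<and>
            (\<forall>\<omega>\<in>space M - A. Q' N x0 (\<lambda>l i j. W l i j \<omega>) (\<lambda>l i. b l i \<omega>))))"
  proof (intro exI[of _ N0] allI impI)
    fix N :: nat and x0 :: "nat \<Rightarrow> real" and M :: "'a measure" and W b
    assume "N0 \<le> N" "\<forall>j\<in>{1..N}. x0 j \<in> {-1, 1}" "gaussian_params D N \<sigma>w \<sigma>b M W b"
    from N0[OF this] show "\<exists>A\<in>sets M. measure M A \<le> \<delta> \<and>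
        (\<forall>\<omega>\<in>space M - A. Q' N x0 (\<lambda>l i j. W l i j \<omega>) (\<lambda>l i. b l i \<omega>))"
      using assms(2) by blast
  qed
qed

text \<open>Union bound: each statement gets half of \<delta>, and the larger threshold serves
  both.\<close>

lemma whp_conj:
  assumes "whp TYPE('a) D \<sigma>w \<sigma>b Q" "whp TYPE('a) D \<sigma>w \<sigma>b Q'"
  shows "whp TYPE('a) D \<sigma>w \<sigma>b (\<lambda>N x0 W b. Q N x0 W b \<and> Q' N x0 W b)"
  unfolding whp_def
proof (intro allI impI)
  fix \<delta> :: real assume "\<delta> > 0"
  then have "\<delta> / 2 > 0" by simp
  obtain N1 where N1: "\<And>N x0 (M :: 'a measure) W b.
    N \<ge> N1 \<Longrightarrow> (\<forall>j\<in>{1..N}. x0 j \<in> {-1, 1}) \<Longrightarrow> gaussian_params D N \<sigma>w \<sigma>b M W b \<Longrightarrow>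
    \<exists>A\<in>sets M. measure M A \<le> \<delta> / 2 \<and> (\<forall>\<omega>\<in>space M - A. Q N x0 (\<lambda>l i j. W l i j \<omega>) (\<lambda>l i. b l i \<omega>))"
    by (rule whpD[OF assms(1) \<open>\<delta> / 2 > 0\<close>]) blast
  obtain N2 where N2: "\<And>N x0 (M :: 'a measure) W b.
    N \<ge> N2 \<Longrightarrow> (\<forall>j\<in>{1..N}. x0 j \<in> {-1, 1}) \<Longrightarrow> gaussian_params D N \<sigma>w \<sigma>b M W b \<Longrightarrow>
    \<exists>A\<in>sets M. measure M A \<le> \<delta> / 2 \<and> (\<forall>\<omega>\<in>space M - A. Q' N x0 (\<lambda>l i j. W l i j \<omega>) (\<lambda>l i. b l i \<omega>))"
    by (rule whpD[OF assms(2) \<open>\<delta> / 2 > 0\<close>]) blast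
  show "\<exists>N0. \<forall>N\<ge>N0. \<forall>x0. (\<forall>j\<in>{1..N}. x0 j \<in> {-1, 1}) \<longrightarrow>
        (\<forall>(M :: 'a measure) W b. gaussian_params D N \<sigma>w \<sigma>b M W b \<longrightarrow>
           (\<exists>A\<in>sets M. measure M A \<le> \<delta> \<and>
              (\<forall>\<omega>\<in>space M - A. Q N x0 (\<lambda>l i j. W l i j \<omega>) (\<lambda>l i. b l i \<omega>) \<and>
                Q' N x0 (\<lambda>l i j. W l i j \<omega>) (\<lambda>l i. b l i \<omega>))))"
  proof (intro exI[of _ "max N1 N2"] allI impI)
    fix N :: nat and x0 :: "nat \<Rightarrow> real" and M :: "'a measure" and W b
    assume "max N1 N2 \<le> N" and x0: "\<forall>j\<in>{1..N}. x0 j \<in> {-1, 1}"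
      and params: "gaussian_params D N \<sigma>w \<sigma>b M W b"
    then obtain A1 A2 where A: "A1 \<in> sets M" "measure M A1 \<le> \<delta> / 2" "A2 \<in> sets M" "measure M A2 \<le> \<delta> / 2"
      "\<forall>\<omega>\<in>space M - A1. Q N x0 (\<lambda>l i j. W l i j \<omega>) (\<lambda>l i. b l i \<omega>)"
      "\<forall>\<omega>\<in>space M - A2. Q' N x0 (\<lambda>l i j. W l i j \<omega>) (\<lambda>l i. b l i \<omega>)"
      using N1[OF _ x0 params] N2[OF _ x0 params] by auto
    interpret prob_space M using params by (simp add: gaussian_params_def)
    have "prob (A1 \<union> A2) \<le> \<delta>"
      using measure_Un_le[OF A(1,3)] A(2,4) by linarith
    then show "\<exists>A\<in>sets M. measure M A \<le> \<delta> \<and>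
        (\<forall>\<omega>\<in>space M - A. Q N x0 (\<lambda>l i j. W l i j \<omega>) (\<lambda>l i. b l i \<omega>) \<and>
          Q' N x0 (\<lambda>l i j. W l i j \<omega>) (\<lambda>l i. b l i \<omega>))"
      using A by (intro bexI[of _ "A1 \<union> A2"]) auto
  qed
qed

lemma whp_Ball_finite:
  assumes "finite L" and "\<And>l. l \<in> L \<Longrightarrow> whp TYPE('a) D \<sigma>w \<sigma>b (Q l)"
  shows "whp TYPE('a) D \<sigma>w \<sigma>b (\<lambda>N x0 W b. \<forall>l\<in>L. Q l N x0 W b)"
  using assms
proof (induction L rule: finite_induct)
  case empty
  show ?case by (rule whpI) simp
next
  case (insert l L)
  then have "whp TYPE('a) D \<sigma>w \<sigma>b (\<lambda>N x0 W b. Q l N x0 W b \<and> (\<forall>l\<in>L. Q l N x0 W b))"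
    by (intro whp_conj) auto
  then show ?case by simp
qed

text \<open>There are two ways to fail: the conditional variance is not near \<open>v\<close>, which
  is unlikely by \<open>prev\<close>, or it is near and the new layer still deviates, which is
  unlikely by concentration. The lower layers use \<phi> but the average uses \<psi>, so the lemma
  serves both the induction (\<psi> = \<phi>) and the claim on \<open>qnet\<close>
  (identity).\<close>

lemma whp_layer:
  assumes \<phi>: "permissible \<phi>" and \<psi>: "permissible \<psi>" and l: "l < D" and v: "v \<ge> 0" and \<eta>: "\<eta> > 0"
    and prev: "\<And>\<kappa>. \<kappa> > 0 \<Longrightarrow> whp TYPE('a) D \<sigma>w \<sigma>b (\<lambda>N x0 W b.
      \<bar>cond_var \<sigma>w \<sigma>b N (act \<phi> N W b x0 l) - v\<bar> \<le> \<kappa> \<and>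
      (v = 0 \<longrightarrow> cond_var \<sigma>w \<sigma>b N (act \<phi> N W b x0 l) = 0))"
  defines "r \<equiv> \<lambda>N x0 W b. (\<Sum>i=1..N. (\<psi> (preact N W b (Suc l) (act \<phi> N W b x0 l) i))\<^sup>2) / real N"
  shows "whp TYPE('a) D \<sigma>w \<sigma>b (\<lambda>N x0 W b.
      \<bar>r N x0 W b - mean_sq \<psi> v\<bar> \<le> \<eta> \<and> (mean_sq \<psi> v = 0 \<longrightarrow> r N x0 W b = 0))"
proof -
  note [measurable] = permissible_measurable[OF \<phi>] permissible_measurable[OF \<psi>]
  \<comment> \<open>Half of \<eta> pays for moving the variance from s to \<open>v\<close>, the
    other half for the fluctuation around \<open>mean_sq \<psi> s\<close>.\<close>
  have "\<eta> / 2 > 0" using \<eta> by simp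
  obtain \<kappa> where \<kappa>: "\<kappa> > 0" "\<kappa> \<le> 1"
    and near: "\<And>s. s \<ge> 0 \<Longrightarrow> \<bar>s - v\<bar> \<le> \<kappa> \<Longrightarrow> (v = 0 \<Longrightarrow> s = 0) \<Longrightarrow>
      \<bar>mean_sq \<psi> s - mean_sq \<psi> v\<bar> < \<eta> / 2 \<and> (mean_sq \<psi> v = 0 \<longrightarrow> mean_sq \<psi> s = 0)"
    by (rule mean_sq_near[OF \<psi> v \<open>\<eta> / 2 > 0\<close>]) blast
  have "v + 1 > 0" using v by simp
  then obtain C where C: "\<forall>s\<in>{0..v + 1}. integrable (gauss s) (\<lambda>y. (\<psi> y) ^ 4) \<and> (LINT y|gauss s. (\<psi> y) ^ 4) \<le> C"
    using permissible_fourth_moment[OF \<psi>] by blast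
  define near_v where "near_v = (\<lambda>s. \<bar>s - v\<bar> \<le> \<kappa> \<and> (v = 0 \<longrightarrow> s = (0::real)))"
  \<comment> \<open>The second way to fail. Requiring \<open>near_v\<close> inside \<open>P\<close>
    makes its probability small for every fixed \<open>x\<close>: otherwise the event is empty, and
    if \<open>near_v\<close> holds the uniform moment bound \<open>C\<close> is available.\<close>
  define P where "P = (\<lambda>N x h. near_v (cond_var \<sigma>w \<sigma>b N x) \<and>
    \<not> (\<bar>(\<Sum>i=1..N. (\<psi> (h i))\<^sup>2) / real N - mean_sq \<psi> v\<bar> \<le> \<eta> \<and>
      (mean_sq \<psi> v = 0 \<longrightarrow> (\<Sum>i=1..N. (\<psi> (h i))\<^sup>2) / real N = 0)))"
  show ?thesis
    unfolding whp_def
  proof (intro allI impI)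
    fix \<delta> :: real assume \<delta>: "\<delta> > 0"
    then have "\<delta> / 2 > 0" by simp
    obtain N1 where N1: "\<And>N x0 (M :: 'a measure) W b.
      N \<ge> N1 \<Longrightarrow> (\<forall>j\<in>{1..N}. x0 j \<in> {-1, 1}) \<Longrightarrow> gaussian_params D N \<sigma>w \<sigma>b M W b \<Longrightarrow>
      \<exists>A\<in>sets M. measure M A \<le> \<delta> / 2 \<and> (\<forall>\<omega>\<in>space M - A.
        near_v (cond_var \<sigma>w \<sigma>b N (act \<phi> N (\<lambda>l i j. W l i j \<omega>) (\<lambda>l i. b l i \<omega>) x0 l)))"
      unfolding near_v_def by (rule whpD[OF prev[OF \<kappa>(1)] \<open>\<delta> / 2 > 0\<close>]) blast
    \<comment> \<open>Chosen so that the Chebyshev bound for deviation \<eta> / 2 is at most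
      \<delta> / 2 from width \<open>N2\<close> on.\<close>
    obtain N2 :: nat where N2: "real N2 \<ge> C / ((\<eta> / 2)\<^sup>2 * (\<delta> / 2))"
      using real_arch_simple by blast
    show "\<exists>N0. \<forall>N\<ge>N0. \<forall>x0. (\<forall>j\<in>{1..N}. x0 j \<in> {-1, 1}) \<longrightarrow>
        (\<forall>(M :: 'a measure) W b. gaussian_params D N \<sigma>w \<sigma>b M W b \<longrightarrow>
           (\<exists>A\<in>sets M. measure M A \<le> \<delta> \<and> (\<forall>\<omega>\<in>space M - A.
             \<bar>r N x0 (\<lambda>l i j. W l i j \<omega>) (\<lambda>l i. b l i \<omega>) - mean_sq \<psi> v\<bar> \<le> \<eta> \<and>
             (mean_sq \<psi> v = 0 \<longrightarrow> r N x0 (\<lambda>l i j. W l i j \<omega>) (\<lambda>l i. b l i \<omega>) = 0))))"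
    proof (intro exI[of _ "max N1 (max N2 1)"] allI impI)
      fix N :: nat and x0 :: "nat \<Rightarrow> real" and M :: "'a measure" and W b
      assume "max N1 (max N2 1) \<le> N" and x0: "\<forall>j\<in>{1..N}. x0 j \<in> {-1, 1}"
        and params: "gaussian_params D N \<sigma>w \<sigma>b M W b"
      then have N: "N \<ge> N1" "N \<ge> N2" "N \<ge> 1" by auto
      interpret prob_space M using params by (simp add: gaussian_params_def)
      have l': "Suc l \<in> {1..D}" using l by simp
      note params_measurable [measurable] = gaussian_params_measurable[OF params l']
      define A2 where "A2 = {\<omega> \<in> space M.
        P N (restrict (act \<phi> N (\<lambda>l i j. W l i j \<omega>) (\<lambda>l i. b l i \<omega>) x0 l) {1..N})
          (restrict (preact N (\<lambda>l i j. W l i j \<omega>) (\<lambda>l i. b l i \<omega>) (Suc l)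
            (act \<phi> N (\<lambda>l i j. W l i j \<omega>) (\<lambda>l i. b l i \<omega>) x0 l)) {1..N})}"
      have P_restrict: "P N (restrict x {1..N}) (restrict h {1..N}) = P N x h"
        "P N x (restrict h {1..N}) = P N x h" for x h
        by (simp_all add: P_def cond_var_def cong: sum.cong_simp)
      have "C / (real N * (\<eta> / 2)\<^sup>2) \<le> \<delta> / 2"
      proof -
        have "C / ((\<eta> / 2)\<^sup>2 * (\<delta> / 2)) \<le> real N" using N2 N(2) by linarith
        then have "C \<le> real N * ((\<eta> / 2)\<^sup>2 * (\<delta> / 2))"
          using \<eta> \<delta> by (subst (asm) pos_divide_le_eq) auto
        then show ?thesis
          using \<eta> N(3) by (subst pos_divide_le_eq) (auto simp: mult_ac)
      qed
      have A2: "A2 \<in> sets M" "measure M A2 \<le> \<delta> / 2"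
        unfolding A2_def
      proof (rule_tac [!] prob_layer_le[OF params l permissible_measurable[OF \<phi>]])
        \<comment> \<open>Both claims about \<open>A2\<close> come from
          \<open>prob_layer_le\<close>, so each of its premises has to be discharged twice.\<close>
        show "Measurable.pred (PiM {1..N} (\<lambda>_. borel) \<Otimes>\<^sub>M PiM {1..N} (\<lambda>_. borel)) (\<lambda>(x, h). P N x h)"
          unfolding P_def near_v_def cond_var_def by measurable
        then show "Measurable.pred (PiM {1..N} (\<lambda>_. borel) \<Otimes>\<^sub>M PiM {1..N} (\<lambda>_. borel)) (\<lambda>(x, h). P N x h)" .
        fix x
        let ?h = "\<lambda>\<omega>. preact N (\<lambda>l i j. W l i j \<omega>) (\<lambda>l i. b l i \<omega>) (Suc l) x"
        let ?s = "cond_var \<sigma>w \<sigma>b N x"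
        show "measure M {\<omega> \<in> space M. P N x (restrict (?h \<omega>) {1..N})} \<le> \<delta> / 2"
        proof (cases "near_v ?s")
          case False
          then show ?thesis using \<delta> by (simp add: P_def)
        next
          case True
          then have close: "\<bar>mean_sq \<psi> ?s - mean_sq \<psi> v\<bar> < \<eta> / 2" "mean_sq \<psi> v = 0 \<Longrightarrow> mean_sq \<psi> ?s = 0"
            using near[OF cond_var_nonneg] by (auto simp: near_v_def)
          have "?s \<in> {0..v + 1}"
            using True \<kappa>(2) cond_var_nonneg[of \<sigma>w \<sigma>b N x] by (auto simp: near_v_def abs_le_iff)
          with C have C': "integrable (gauss ?s) (\<lambda>y. (\<psi> y) ^ 4)" "(LINT y|gauss ?s. (\<psi> y) ^ 4) \<le> C"
            by auto
          note conc = layer_concentration[OF params l' N(3) \<psi> \<open>\<eta> / 2 > 0\<close> C']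
          let ?B = "{\<omega> \<in> space M. \<eta> / 2 \<le> \<bar>(\<Sum>i=1..N. (\<psi> (?h \<omega> i))\<^sup>2) / real N - mean_sq \<psi> ?s\<bar>}"
          have ae: "AE \<omega> in M. mean_sq \<psi> v = 0 \<longrightarrow> (\<Sum>i=1..N. (\<psi> (?h \<omega> i))\<^sup>2) = 0"
            using conc(2) close(2) by (cases "mean_sq \<psi> v = 0") auto
          have "measure M {\<omega> \<in> space M. P N x (restrict (?h \<omega>) {1..N})} \<le> measure M ?B"
          proof (rule finite_measure_mono_AE)
            have [measurable]: "(\<lambda>\<omega>. ?h \<omega> i) \<in> borel_measurable M" if "i \<in> {1..N}" for i
              unfolding preact_def using that by measurable
            show "?B \<in> sets M" by measurable
            \<comment> \<open>The inclusion holds only almost everywhere: the zero clause in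
              \<open>P\<close> can be violated on a null set. Elsewhere \<open>P\<close> means a
              deviation above \<eta> from \<open>mean_sq \<psi> v\<close>, hence at least \<eta> / 2
              from \<open>mean_sq \<psi> ?s\<close>.\<close>
            show "AE \<omega> in M. \<omega> \<in> {\<omega> \<in> space M. P N x (restrict (?h \<omega>) {1..N})} \<longrightarrow> \<omega> \<in> ?B"
              using ae
            proof (rule eventually_mono, intro impI)
              fix \<omega>
              define S where "S = (\<Sum>i=1..N. (\<psi> (?h \<omega> i))\<^sup>2)"
              assume S0: "mean_sq \<psi> v = 0 \<longrightarrow> (\<Sum>i=1..N. (\<psi> (?h \<omega> i))\<^sup>2) = 0"
                and "\<omega> \<in> {\<omega> \<in> space M. P N x (restrict (?h \<omega>) {1..N})}"
              then have \<omega>: "\<omega> \<in> space M" and "P N x (?h \<omega>)"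
                unfolding mem_Collect_eq P_restrict by blast+
              then have "\<not> (\<bar>S / real N - mean_sq \<psi> v\<bar> \<le> \<eta> \<and> (mean_sq \<psi> v = 0 \<longrightarrow> S / real N = 0))"
                unfolding P_def S_def by blast
              moreover have "mean_sq \<psi> v = 0 \<longrightarrow> S / real N = 0"
                using S0 by (simp add: S_def)
              ultimately have "\<not> \<bar>S / real N - mean_sq \<psi> v\<bar> \<le> \<eta>" by blast
              with close(1) have "\<eta> / 2 \<le> \<bar>S / real N - mean_sq \<psi> ?s\<bar>" by linarith
              with \<omega> show "\<omega> \<in> ?B" unfolding S_def by blast
            qed
          qed
          also have "\<dots> \<le> C / (real N * (\<eta> / 2)\<^sup>2)" by (rule conc(1))
          also have "\<dots> \<le> \<delta> / 2" by fact
          finally show ?thesis .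
        qed
        then show "measure M {\<omega> \<in> space M. P N x (restrict (?h \<omega>) {1..N})} \<le> \<delta> / 2" .
      qed
      obtain A1 where A1: "A1 \<in> sets M" "measure M A1 \<le> \<delta> / 2"
        "\<forall>\<omega>\<in>space M - A1. near_v (cond_var \<sigma>w \<sigma>b N (act \<phi> N (\<lambda>l i j. W l i j \<omega>) (\<lambda>l i. b l i \<omega>) x0 l))"
        using N1[OF N(1) x0 params] by blast
      have "prob (A1 \<union> A2) \<le> \<delta>"
        using measure_Un_le[OF A1(1) A2(1)] A1(2) A2(2) by linarith
      moreover have "\<bar>r N x0 (\<lambda>l i j. W l i j \<omega>) (\<lambda>l i. b l i \<omega>) - mean_sq \<psi> v\<bar> \<le> \<eta> \<and>
             (mean_sq \<psi> v = 0 \<longrightarrow> r N x0 (\<lambda>l i j. W l i j \<omega>) (\<lambda>l i. b l i \<omega>) = 0)"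
        if "\<omega> \<in> space M - (A1 \<union> A2)" for \<omega>
      proof -
        let ?x = "act \<phi> N (\<lambda>l i j. W l i j \<omega>) (\<lambda>l i. b l i \<omega>) x0 l"
        have "\<not> P N ?x (preact N (\<lambda>l i j. W l i j \<omega>) (\<lambda>l i. b l i \<omega>) (Suc l) ?x)"
          using that unfolding A2_def P_restrict(1) by blast
        moreover have "near_v (cond_var \<sigma>w \<sigma>b N ?x)"
          using that A1(3) by blast
        ultimately show ?thesis
          unfolding P_def r_def by blast
      qed
      ultimately show "\<exists>A\<in>sets M. measure M A \<le> \<delta> \<and> (\<forall>\<omega>\<in>space M - A.
             \<bar>r N x0 (\<lambda>l i j. W l i j \<omega>) (\<lambda>l i. b l i \<omega>) - mean_sq \<psi> v\<bar> \<le> \<eta> \<and>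
             (mean_sq \<psi> v = 0 \<longrightarrow> r N x0 (\<lambda>l i j. W l i j \<omega>) (\<lambda>l i. b l i \<omega>) = 0))"
        using A1(1) A2(1) by (intro bexI[of _ "A1 \<union> A2"]) auto
    qed
  qed
qed

section \<open>The length map as the limit along the layers\<close>

lemma rmap_Suc_eq_mean_sq:
  assumes "permissible \<phi>" "qmap \<phi> \<sigma>w \<sigma>b (Suc l) \<ge> 0"
  shows "rmap \<phi> \<sigma>w \<sigma>b (Suc l) = mean_sq \<phi> (qmap \<phi> \<sigma>w \<sigma>b (Suc l))"
  using assms by (simp add: mean_sq_eq del: qmap.simps)

lemma qmap_nonneg: "qmap \<phi> \<sigma>w \<sigma>b l \<ge> 0"
proof (cases l)
  case (Suc k)
  have "rmap \<phi> \<sigma>w \<sigma>b k \<ge> 0" by (cases k) (auto simp del: qmap.simps)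
  with Suc show ?thesis by simp
qed simp

text \<open>With the identity for \<psi>, the limit in \<open>whp_layer\<close> is thus
  \<open>qmap\<close> itself.\<close>

lemma mean_sq_id:
  assumes "v \<ge> 0"
  shows "mean_sq (\<lambda>x. x) v = v"
proof -
  have "(LINT z|gauss 1. z\<^sup>2) = 1"
    using integral_std_normal_moment_even[of 1] by (simp add: gauss_def integral_density)
  then show ?thesis
    using assms by (simp add: mean_sq_eq permissible_id power_mult_distrib)
qed

text \<open>The activations of layer \<open>l\<close> determine the variance in layer
  \<open>Suc l\<close>, hence the shift of the index. For the input layer the claim is
  deterministic, as entries 1 and -1 have mean square exactly 1.\<close>

lemma whp_cond_var:
  assumes \<phi>: "permissible \<phi>" and "l < D" and "\<kappa> > 0"
  shows "whp TYPE('a) D \<sigma>w \<sigma>b (\<lambda>N x0 W b.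
      \<bar>cond_var \<sigma>w \<sigma>b N (act \<phi> N W b x0 l) - qmap \<phi> \<sigma>w \<sigma>b (Suc l)\<bar> \<le> \<kappa> \<and>
      (qmap \<phi> \<sigma>w \<sigma>b (Suc l) = 0 \<longrightarrow> cond_var \<sigma>w \<sigma>b N (act \<phi> N W b x0 l) = 0))"
  using assms(2,3)
proof (induction l arbitrary: \<kappa>)
  case 0
  show ?case
  proof (rule whpI)
    fix N :: nat and x0 :: "nat \<Rightarrow> real" and W b
    assume N: "N \<ge> 1" and x0: "\<And>j. j \<in> {1..N} \<Longrightarrow> x0 j \<in> {-1, 1}"
    have "(\<Sum>j=1..N. (x0 j)\<^sup>2) = (\<Sum>j=1..N. 1)"
      by (rule sum.cong) (use x0 in fastforce)+
    then have "cond_var \<sigma>w \<sigma>b N (act \<phi> N W b x0 0) = qmap \<phi> \<sigma>w \<sigma>b (Suc 0)"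
      using N by (simp add: cond_var_def)
    then show "\<bar>cond_var \<sigma>w \<sigma>b N (act \<phi> N W b x0 0) - qmap \<phi> \<sigma>w \<sigma>b (Suc 0)\<bar> \<le> \<kappa> \<and>
      (qmap \<phi> \<sigma>w \<sigma>b (Suc 0) = 0 \<longrightarrow> cond_var \<sigma>w \<sigma>b N (act \<phi> N W b x0 0) = 0)"
      using 0 by (simp del: qmap.simps)
  qed
next
  case (Suc l)
  let ?v = "qmap \<phi> \<sigma>w \<sigma>b (Suc l)"
  \<comment> \<open>The tolerance for the mean square is \<kappa> divided by
    \<open>\<sigma>w\<^sup>2 + 1\<close>, which is positive even if \<sigma>w = 0.\<close>
  have pos: "\<sigma>w\<^sup>2 + 1 > 0" using zero_le_power2[of \<sigma>w] by linarith
  have "whp TYPE('a) D \<sigma>w \<sigma>b (\<lambda>N x0 W b.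
      \<bar>(\<Sum>i=1..N. (\<phi> (preact N W b (Suc l) (act \<phi> N W b x0 l) i))\<^sup>2) / real N - mean_sq \<phi> ?v\<bar> \<le> \<kappa> / (\<sigma>w\<^sup>2 + 1) \<and>
      (mean_sq \<phi> ?v = 0 \<longrightarrow> (\<Sum>i=1..N. (\<phi> (preact N W b (Suc l) (act \<phi> N W b x0 l) i))\<^sup>2) / real N = 0))"
    using Suc pos by (intro whp_layer \<phi> qmap_nonneg) auto
  then show ?case
  proof (rule whp_mono)
    fix N :: nat and x0 :: "nat \<Rightarrow> real" and W b
    define r where "r = (\<Sum>i=1..N. (\<phi> (preact N W b (Suc l) (act \<phi> N W b x0 l) i))\<^sup>2) / real N"
    define m where "m = mean_sq \<phi> ?v"
    assume "\<bar>(\<Sum>i=1..N. (\<phi> (preact N W b (Suc l) (act \<phi> N W b x0 l) i))\<^sup>2) / real N - mean_sq \<phi> ?v\<bar> \<le> \<kappa> / (\<sigma>w\<^sup>2 + 1) \<and>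
      (mean_sq \<phi> ?v = 0 \<longrightarrow> (\<Sum>i=1..N. (\<phi> (preact N W b (Suc l) (act \<phi> N W b x0 l) i))\<^sup>2) / real N = 0)"
    then have *: "\<bar>r - m\<bar> \<le> \<kappa> / (\<sigma>w\<^sup>2 + 1)" "m = 0 \<Longrightarrow> r = 0"
      by (simp_all add: r_def m_def)
    have s: "cond_var \<sigma>w \<sigma>b N (act \<phi> N W b x0 (Suc l)) = \<sigma>w\<^sup>2 * r + \<sigma>b\<^sup>2"
      by (simp add: cond_var_def r_def)
    have q: "qmap \<phi> \<sigma>w \<sigma>b (Suc (Suc l)) = \<sigma>w\<^sup>2 * m + \<sigma>b\<^sup>2"
      using rmap_Suc_eq_mean_sq[OF \<phi> qmap_nonneg] by (simp add: m_def)
    have "\<bar>\<sigma>w\<^sup>2 * r - \<sigma>w\<^sup>2 * m\<bar> = \<sigma>w\<^sup>2 * \<bar>r - m\<bar>"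
      by (simp add: right_diff_distrib[symmetric] abs_mult)
    also have "\<dots> \<le> (\<sigma>w\<^sup>2 + 1) * \<bar>r - m\<bar>"
      by (intro mult_right_mono) auto
    also have "\<dots> \<le> \<kappa>"
      using *(1) pos by (simp add: field_simps)
    finally have "\<bar>\<sigma>w\<^sup>2 * r - \<sigma>w\<^sup>2 * m\<bar> \<le> \<kappa>" .
    \<comment> \<open>A zero limit makes both nonnegative terms vanish, so \<sigma>w = 0 or m = 0;
      in the latter case r = 0 exactly.\<close>
    moreover have "\<sigma>w\<^sup>2 * r + \<sigma>b\<^sup>2 = 0" if "\<sigma>w\<^sup>2 * m + \<sigma>b\<^sup>2 = 0"
    proof -
      have "m \<ge> 0" unfolding m_def by (rule mean_sq_nonneg)
      with that have "\<sigma>w\<^sup>2 * m = 0" "\<sigma>b\<^sup>2 = 0"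
        by (simp_all add: add_nonneg_eq_0_iff)
      with *(2) show ?thesis by auto
    qed
    ultimately show "\<bar>cond_var \<sigma>w \<sigma>b N (act \<phi> N W b x0 (Suc l)) - qmap \<phi> \<sigma>w \<sigma>b (Suc (Suc l))\<bar> \<le> \<kappa> \<and>
      (qmap \<phi> \<sigma>w \<sigma>b (Suc (Suc l)) = 0 \<longrightarrow> cond_var \<sigma>w \<sigma>b N (act \<phi> N W b x0 (Suc l)) = 0)"
      unfolding s q by auto
  qed
qed

lemma whp_qnet:
  assumes \<phi>: "permissible \<phi>" and "l \<le> D" and \<epsilon>: "\<epsilon> > 0"
  shows "whp TYPE('a) D \<sigma>w \<sigma>b (\<lambda>N x0 W b. \<bar>qnet \<phi> N W b x0 l - qmap \<phi> \<sigma>w \<sigma>b l\<bar> \<le> \<epsilon>)"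
proof (cases l)
  case 0
  then show ?thesis using \<epsilon> by (intro whpI) simp
next
  case (Suc k)
  with assms have "whp TYPE('a) D \<sigma>w \<sigma>b (\<lambda>N x0 W b.
      \<bar>(\<Sum>i=1..N. (preact N W b (Suc k) (act \<phi> N W b x0 k) i)\<^sup>2) / real N - mean_sq (\<lambda>x. x) (qmap \<phi> \<sigma>w \<sigma>b (Suc k))\<bar> \<le> \<epsilon> \<and>
      (mean_sq (\<lambda>x. x) (qmap \<phi> \<sigma>w \<sigma>b (Suc k)) = 0 \<longrightarrow>
        (\<Sum>i=1..N. (preact N W b (Suc k) (act \<phi> N W b x0 k) i)\<^sup>2) / real N = 0))"
    by (intro whp_layer permissible_id whp_cond_var qmap_nonneg) auto
  then show ?thesis
    unfolding Suc by (rule whp_mono) (simp add: mean_sq_id qmap_nonneg del: qmap.simps)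
qed

text \<open>\<open>whp\<close> only yields a measurable set inside the good event. To pass to the
  good event itself by monotonicity, that event has to be measurable, as \<open>measure\<close> is 0
  on other sets.\<close>

lemma measurable_qnet:
  assumes params: "gaussian_params D N \<sigma>w \<sigma>b M W b" and \<phi>: "\<phi> \<in> borel_measurable borel" and l: "l \<le> D"
  shows "(\<lambda>\<omega>. qnet \<phi> N (\<lambda>l i j. W l i j \<omega>) (\<lambda>l i. b l i \<omega>) x0 l) \<in> borel_measurable M"
proof (cases l)
  case 0
  then show ?thesis by simp
next
  case (Suc k)
  note W = gaussian_params_measurable[OF params]
  have "(\<lambda>\<omega>. act \<phi> N (\<lambda>l i j. W l i j \<omega>) (\<lambda>l i. b l i \<omega>) x0 k i) \<in> borel_measurable M"
    if "i \<in> {1..N}" for i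
    by (rule measurable_act[OF \<phi>]) (use W l Suc that in auto)
  then show ?thesis
    unfolding Suc qnet.simps preact_def using W l Suc
    by (intro borel_measurable_divide borel_measurable_sum borel_measurable_power borel_measurable_add
        borel_measurable_times) auto
qed

theorem theorem2:
  fixes \<phi> :: "real \<Rightarrow> real" and \<sigma>w \<sigma>b \<epsilon> \<delta> :: real and D :: nat
  assumes "permissible \<phi>"
    and "\<sigma>w \<ge> 0" and "\<sigma>b \<ge> 0"
    and "D \<ge> 1"
    and "\<epsilon> > 0" and "\<delta> > 0"
  shows "\<exists>N0::nat. \<forall>N\<ge>N0. \<forall>x0 :: nat \<Rightarrow> real. (\<forall>j\<in>{1..N}. x0 j \<in> {-1, 1}) \<longrightarrow>
           (\<forall>(M :: 'a measure) W b. gaussian_params D N \<sigma>w \<sigma>b M W b \<longrightarrow>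
              measure M {\<omega> \<in> space M. \<forall>l\<in>{0..D}.
                \<bar>qnet \<phi> N (\<lambda>l i j. W l i j \<omega>) (\<lambda>l i. b l i \<omega>) x0 l - qmap \<phi> \<sigma>w \<sigma>b l\<bar> \<le> \<epsilon>}
              \<ge> 1 - \<delta>)"
proof -
  \<comment> \<open>The finitely many layers are combined by the union bound, which makes the claim
    simultaneous in l.\<close>
  have "whp TYPE('a) D \<sigma>w \<sigma>b (\<lambda>N x0 W b. \<forall>l\<in>{0..D}. \<bar>qnet \<phi> N W b x0 l - qmap \<phi> \<sigma>w \<sigma>b l\<bar> \<le> \<epsilon>)"
    using assms by (intro whp_Ball_finite whp_qnet) auto
  then obtain N0 where N0: "\<And>N x0 (M :: 'a measure) W b.
      N \<ge> N0 \<Longrightarrow> (\<forall>j\<in>{1..N}. x0 j \<in> {-1, 1}) \<Longrightarrow> gaussian_params D N \<sigma>w \<sigma>b M W b \<Longrightarrow>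
      \<exists>A\<in>sets M. measure M A \<le> \<delta> \<and> (\<forall>\<omega>\<in>space M - A.
        \<forall>l\<in>{0..D}. \<bar>qnet \<phi> N (\<lambda>l i j. W l i j \<omega>) (\<lambda>l i. b l i \<omega>) x0 l - qmap \<phi> \<sigma>w \<sigma>b l\<bar> \<le> \<epsilon>)"
    using \<open>\<delta> > 0\<close> by (rule whpD) blast
  show ?thesis
  proof (intro exI[of _ N0] allI impI)
    fix N :: nat and x0 :: "nat \<Rightarrow> real" and M :: "'a measure" and W b
    assume "N0 \<le> N" and x0: "\<forall>j\<in>{1..N}. x0 j \<in> {-1, 1}" and params: "gaussian_params D N \<sigma>w \<sigma>b M W b"
    interpret prob_space M using params by (simp add: gaussian_params_def)
    let ?G = "{\<omega> \<in> space M. \<forall>l\<in>{0..D}.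
      \<bar>qnet \<phi> N (\<lambda>l i j. W l i j \<omega>) (\<lambda>l i. b l i \<omega>) x0 l - qmap \<phi> \<sigma>w \<sigma>b l\<bar> \<le> \<epsilon>}"
    obtain A where A: "A \<in> sets M" "prob A \<le> \<delta>" "space M - A \<subseteq> ?G"
      using N0[OF \<open>N0 \<le> N\<close> x0 params] by blast
    have [measurable]: "(\<lambda>\<omega>. qnet \<phi> N (\<lambda>l i j. W l i j \<omega>) (\<lambda>l i. b l i \<omega>) x0 l) \<in> borel_measurable M"
      if "l \<in> {0..D}" for l
      using that by (intro measurable_qnet[OF params] permissible_measurable assms) auto
    have "?G \<in> sets M" by measurable
    then have "prob (space M - A) \<le> prob ?G"
      using A(3) by (intro finite_measure_mono) auto
    with A show "1 - \<delta> \<le> measure M ?G" by (simp add: prob_compl)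
  qed
qed

end
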